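(* Let $f:M\to S^5$ be the link of a special Lagrangian cone $C(M)\subset\mathbb{C}^3$, and let $\gamma_M$ be the Gauss map of $f$. Then the map $\psi_1=(f,f\wedge\gamma_M):M\to FL_1$ is primitive harmonic. Conversely, any primitive harmonic map $M\to FL_1$ projects by $\pi_2$ to the Gauss map of an immersed special Lagrangian cone $\kappa:C(M)\to\mathbb{C}^3$ (this Gauss map being regarded as a map on $M$) and by $\pi_1$ to a minimal Legendrian map $f:M\to S^5$.
   Context: For vectors $v_1,v_2,v_3\in\mathbb{C}^3$, $v_1\wedge v_2\wedge v_3$ denotes the real oriented 3-plane with real span $\mathrm{Sp}_{\mathbb{R}}\{v_1,v_2,v_3\}$; $e_1,e_2,e_3$ is the standard unitary basis. $SL=\{g(e_1\wedge e_2\wedge e_3):g\in SU_3\}\cong SU_3/SO_3$ is the set of special Lagrangian 3-planes; a real oriented 3-submanifold of $\mathbb{C}^3$ is special Lagrangian if its Gauss map takes values in $SL$. A cone $C(M)$ is the union of $\{0\}$ and all open rays from the origin through the points of a connected oriented surface $M$ in $S^5\subset\mathbb{C}^3$, called its link, with inclusion or immersion $f:M\to S^5$ (an immersed cone, written $\kappa:C(M)\to\mathbb{C}^3$, is the version in which the surface is only immersed in $S^5$); it is special Lagrangian if it is so away from the origin. The Gauss map of the cone away from the origin factors through $M$ as $f\wedge\gamma_M:M\to SL$, where $\gamma_M:M\to Gr_{\mathbb{R}}(2,\mathbb{C}^3)$ is the Gauss map of $f$; for $z=x+iy$ a local conformal coordinate compatible with the orientation, $f\wedge\gamma_M=f\wedge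 f_x\wedge f_y$. In the first assertion $M$ has the complex structure given by its orientation and the metric induced by $f$; in the converse $M$ is a Riemann surface. Legendrian is with respect to the standard contact structure of $S^5$. $FL_1=\{(v,V)\in S^5\times SL: v\in V\}=\{(ge_1,g(e_1\wedge e_2\wedge e_3)):g\in SU_3\}\cong SU_3/K_1$, with $K_1=\{g\in SO_3:ge_1=e_1\}\cong SO_2$. The projections are $\pi_1:FL_1\to S^5$, $(v,V)\mapsto v$, and $\pi_2:FL_1\to SL$, $(v,V)\mapsto V$. $FL_1$ is the 6-symmetric space for the order six automorphism $\hat\sigma(g)=R(g^{-1})^tR^{-1}$ of $SU_3$, where $R$ is the rotation about the $e_1$ axis through angle $\pi/3$ given by $$R=\begin{pmatrix}1&0&0\\0&\cos(\pi/3)&\sin(\pi/3)\\0&-\sin(\pi/3)&\cos(\pi/3)\end{pmatrix},$$ whose fixed point subgroup is $K_1$. With $\epsilon=e^{2\pi i/3}$, let $\hat{\mathfrak{g}}_1=\{X\in\mathfrak{sl}_3(\mathbb{C}):-RX^tR^{-1}=-\epsilon X\}$ (the $(-\epsilon)$-eigenspace of $\hat\sigma$), and let $[\hat{\mathfrak{g}}_1]\subset T^{\mathbb{C}}FL_1$ be the subbundle whose fibre at $gK_1$ is the image of $\hat{\mathfrak{g}}_1$ under the complex linear extension of $X\mapsto\frac{d}{dt}\big|_{t=0}g e^{tX}K_1$. A smoothly immersed surface $\psi:M\to FL_1$, with $M$ a Riemann surface, is primitive if $d\psi(\partial/\partial z)$ takes values in $[\hat{\mathfrak{g}}_1]$;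 every primitive map is harmonic for any $SU_3$-invariant metric for which $[\hat{\mathfrak{g}}_1]$ is isotropic, and "primitive harmonic" refers to this.
   Formalization: In the converse, the immersed special Lagrangian cone and its Gauss map are asserted only over the points where f=π_1∘ψ is an immersion (the fibres S^2 of π_1 are primitive with f constant, so the claim on all of M fails); f is minimal Legendrian, possibly with critical points, on all of M. *)

theory Defs
  imports "HOL-Analysis.Analysis" "HOL-Library.FuncSet"
begin

section \<open>Smooth functions on open subsets of normed spaces\<close>

primrec Ck_on :: "nat \<Rightarrow> 'a::real_normed_vector set \<Rightarrow> ('a \<Rightarrow> 'b::real_normed_vector) \<Rightarrow> bool" where
  "Ck_on 0 S f \<longleftrightarrow> continuous_on S f"
| "Ck_on (Suc k) S f \<longleftrightarrow>
     (\<forall>x\<in>S. f differentiable (at x)) \<and> (\<forall>v. Ck_on k S (\<lambda>x. frechet_derivative f (at x) v))"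

text \<open>Used for open \<open>S\<close> in finite dimensional spaces only.\<close>

definition smooth_on :: "'a::real_normed_vector set \<Rightarrow> ('a \<Rightarrow> 'b::real_normed_vector) \<Rightarrow> bool" where
  "smooth_on S f \<longleftrightarrow> (\<forall>k. Ck_on k S f)"


section \<open>Surfaces\<close>

text \<open>
  A chart is a coordinate domain together with a complex valued coordinate \<open>z = x + iy\<close>.  Surfaces
  are abstract topological spaces with an atlas (not necessarily maximal) of such charts; the complex
  plane serves as model space both for oriented smooth surfaces, with the orientation \<open>1, i\<close>, and
  for Riemann surfaces.
\<close>

type_synonym 'a chart = "'a set \<times> ('a \<Rightarrow> complex)"

definition is_chart :: "'a topology \<Rightarrow> 'a chart \<Rightarrow> bool" where
  "is_chart X c \<longleftrightarrow> openin X (fst c) \<and> open (snd c ` fst c) \<and>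
     homeomorphic_map (subtopology X (fst c)) (top_of_set (snd c ` fst c)) (snd c)"

definition is_atlas :: "'a topology \<Rightarrow> 'a chart set \<Rightarrow> bool" where
  "is_atlas X A \<longleftrightarrow> (\<forall>c\<in>A. is_chart X c) \<and> \<Union>(fst ` A) = topspace X"

definition in_chart :: "'a chart \<Rightarrow> ('a \<Rightarrow> 'b) \<Rightarrow> complex \<Rightarrow> 'b" where
  "in_chart c h = h \<circ> inv_into (fst c) (snd c)"

definition transition :: "'a chart \<Rightarrow> 'a chart \<Rightarrow> complex \<Rightarrow> complex" where
  "transition c d = in_chart c (snd d)"

definition jacobian :: "(complex \<Rightarrow> complex) \<Rightarrow> real" where
  "jacobian L = Im (cnj (L 1) * L \<i>)"

definition oriented_atlas :: "'a topology \<Rightarrow> 'a chart set \<Rightarrow> bool" where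
  "oriented_atlas X A \<longleftrightarrow> is_atlas X A \<and>
     (\<forall>c\<in>A. \<forall>d\<in>A. smooth_on (snd c ` (fst c \<inter> fst d)) (transition c d) \<and>
        (\<forall>z \<in> snd c ` (fst c \<inter> fst d). jacobian (frechet_derivative (transition c d) (at z)) > 0))"

definition complex_atlas :: "'a topology \<Rightarrow> 'a chart set \<Rightarrow> bool" where
  "complex_atlas X C \<longleftrightarrow> is_atlas X C \<and>
     (\<forall>c\<in>C. \<forall>d\<in>C. transition c d holomorphic_on (snd c ` (fst c \<inter> fst d)))"

definition surface_space :: "'a topology \<Rightarrow> bool" where
  "surface_space X \<longleftrightarrow> topspace X \<noteq> {} \<and> connected_space X \<and> Hausdorff_space X \<and> second_countable X"

definition oriented_surface :: "'a topology \<Rightarrow> 'a chart set \<Rightarrow> bool" where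
  "oriented_surface X A \<longleftrightarrow> surface_space X \<and> oriented_atlas X A"

definition riemann_surface :: "'a topology \<Rightarrow> 'a chart set \<Rightarrow> bool" where
  "riemann_surface X C \<longleftrightarrow> surface_space X \<and> complex_atlas X C"

definition dmap :: "'a chart \<Rightarrow> ('a \<Rightarrow> 'b::real_normed_vector) \<Rightarrow> 'a \<Rightarrow> complex \<Rightarrow> 'b" where
  "dmap c h p w = frechet_derivative (in_chart c h) (at (snd c p)) w"

abbreviation d_x :: "'a chart \<Rightarrow> ('a \<Rightarrow> 'b::real_normed_vector) \<Rightarrow> 'a \<Rightarrow> 'b" where
  "d_x c h p \<equiv> dmap c h p 1"

abbreviation d_y :: "'a chart \<Rightarrow> ('a \<Rightarrow> 'b::real_normed_vector) \<Rightarrow> 'a \<Rightarrow> 'b" where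
  "d_y c h p \<equiv> dmap c h p \<i>"

text \<open>Second coordinate derivatives: \<open>dmap2 c h p 1 \<i>\<close> is \<open>h\<^sub>x\<^sub>y\<close> at \<open>p\<close>.\<close>

definition dmap2 :: "'a chart \<Rightarrow> ('a \<Rightarrow> 'b::real_normed_vector) \<Rightarrow> 'a \<Rightarrow> complex \<Rightarrow> complex \<Rightarrow> 'b" where
  "dmap2 c h p u v =
     frechet_derivative (\<lambda>z. frechet_derivative (in_chart c h) (at z) u) (at (snd c p)) v"

definition smooth_map_on :: "'a chart set \<Rightarrow> 'a set \<Rightarrow> ('a \<Rightarrow> 'b::real_normed_vector) \<Rightarrow> bool" where
  "smooth_map_on A S h \<longleftrightarrow> (\<forall>c\<in>A. smooth_on (snd c ` (fst c \<inter> S)) (in_chart c h))"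

definition immersion_on :: "'a chart set \<Rightarrow> 'a set \<Rightarrow> ('a \<Rightarrow> 'b::real_normed_vector) \<Rightarrow> bool" where
  "immersion_on A S h \<longleftrightarrow> smooth_map_on A S h \<and> (\<forall>c\<in>A. \<forall>p \<in> fst c \<inter> S. inj (dmap c h p))"

text \<open>
  The differential of the projection to the sphere of a primitive map into the flag manifold below may
  vanish at some points, or identically (the fibres of that projection are 2-spheres which are
  themselves primitive); the cone over it is immersed precisely over its regular points.
\<close>

definition regular_points :: "'a topology \<Rightarrow> 'a chart set \<Rightarrow> ('a \<Rightarrow> 'b::real_normed_vector) \<Rightarrow> 'a set" where
  "regular_points X A h = {p \<in> topspace X. \<forall>c\<in>A. p \<in> fst c \<longrightarrow> inj (dmap c h p)}"

text \<open>Zeros of the differential are allowed.\<close>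

definition weakly_conformal :: "'a chart set \<Rightarrow> ('a \<Rightarrow> 'b::real_inner) \<Rightarrow> bool" where
  "weakly_conformal C f \<longleftrightarrow>
     (\<forall>c\<in>C. \<forall>p \<in> fst c. norm (d_x c f p) = norm (d_y c f p) \<and> d_x c f p \<bullet> d_y c f p = 0)"

text \<open>
  The complex structure \<open>C\<close> is the one determined by the orientation of \<open>A\<close> and the metric induced by
  the immersion \<open>f\<close>: its coordinates are oriented smooth coordinates of \<open>(X, A)\<close> which are conformal
  for the induced metric.
\<close>

definition induced_complex_structure ::
    "'a topology \<Rightarrow> 'a chart set \<Rightarrow> ('a \<Rightarrow> 'b::real_inner) \<Rightarrow> 'a chart set \<Rightarrow> bool" where
  "induced_complex_structure X A f C \<longleftrightarrow>
     complex_atlas X C \<and> oriented_atlas X (A \<union> C) \<and> weakly_conformal C f"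


section \<open>Special Lagrangian planes and cones\<close>

definition S5 :: "(complex^3) set" where
  "S5 = sphere 0 1"

definition herm_transpose :: "complex^3^3 \<Rightarrow> complex^3^3" where
  "herm_transpose X = (\<chi> i j. cnj (X $ j $ i))"

definition SU3 :: "(complex^3^3) set" where
  "SU3 = {g. herm_transpose g ** g = mat 1 \<and> det g = 1}"

text \<open>
  An oriented real 3-plane is represented by the set of its oriented real bases, a basis
  \<open>F$1, F$2, F$3\<close> being stored as the rows of a matrix \<open>F\<close>.  The plane
  \<open>v\<^sub>1 \<and> v\<^sub>2 \<and> v\<^sub>3\<close> is \<open>oplane v1 v2 v3\<close>, for \<open>v1, v2, v3\<close> linearly independent over the reals.
\<close>

type_synonym oriented_plane = "(complex^3^3) set"

definition oplane :: "complex^3 \<Rightarrow> complex^3 \<Rightarrow> complex^3 \<Rightarrow> oriented_plane" where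
  "oplane v1 v2 v3 =
     {F. \<exists>A::real^3^3. det A > 0 \<and> (\<forall>i. F $ i = A$i$1 *\<^sub>R v1 + A$i$2 *\<^sub>R v2 + A$i$3 *\<^sub>R v3)}"

definition underlying_plane :: "oriented_plane \<Rightarrow> (complex^3) set" where
  "underlying_plane V = {v. \<exists>F\<in>V. v \<in> span (rows F)}"

definition act_plane :: "complex^3^3 \<Rightarrow> oriented_plane" where
  "act_plane g = oplane (g *v axis 1 1) (g *v axis 2 1) (g *v axis 3 1)"

definition SL :: "oriented_plane set" where
  "SL = act_plane ` SU3"

text \<open>
  Away from its vertex, the (immersed) cone over \<open>f\<close> is parametrised by
  \<open>\<kappa> (r, p) = r f(p)\<close>, \<open>r > 0\<close>, and oriented by the radial direction followed by the orientation of
  the surface.  Its Gauss map is computed in an oriented coordinate of the surface.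
\<close>

definition cone_map :: "'a chart \<Rightarrow> ('a \<Rightarrow> complex^3) \<Rightarrow> real \<times> complex \<Rightarrow> complex^3" where
  "cone_map c f = (\<lambda>(r, z). r *\<^sub>R in_chart c f z)"

definition cone_gauss :: "'a chart \<Rightarrow> ('a \<Rightarrow> complex^3) \<Rightarrow> real \<Rightarrow> 'a \<Rightarrow> oriented_plane" where
  "cone_gauss c f r p =
     (let D = frechet_derivative (cone_map c f) (at (r, snd c p))
      in oplane (D (1, 0)) (D (0, 1)) (D (0, \<i>)))"

text \<open>\<open>f\<close>, restricted to the open set \<open>S\<close>, is the link of an immersed special Lagrangian cone.\<close>

definition special_lagrangian_cone_on :: "'a chart set \<Rightarrow> 'a set \<Rightarrow> ('a \<Rightarrow> complex^3) \<Rightarrow> bool" where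
  "special_lagrangian_cone_on A S f \<longleftrightarrow> f ` S \<subseteq> S5 \<and> immersion_on A S f \<and>
     (\<forall>c\<in>A. \<forall>p \<in> fst c \<inter> S. \<forall>r>0. cone_gauss c f r p \<in> SL)"

text \<open>\<open>G\<close> is the Gauss map of the cone over \<open>f\<close>, regarded as a map on the link.\<close>

definition cone_gauss_map_on ::
    "'a chart set \<Rightarrow> 'a set \<Rightarrow> ('a \<Rightarrow> complex^3) \<Rightarrow> ('a \<Rightarrow> oriented_plane) \<Rightarrow> bool" where
  "cone_gauss_map_on A S f G \<longleftrightarrow> (\<forall>c\<in>A. \<forall>p \<in> fst c \<inter> S. \<forall>r>0. G p = cone_gauss c f r p)"


section \<open>Minimal Legendrian maps into the 5-sphere\<close>

text \<open>The standard contact distribution, as a subspace of the tangent space of the sphere at \<open>v\<close>.\<close>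

definition contact_plane :: "complex^3 \<Rightarrow> (complex^3) set" where
  "contact_plane v = {w. w \<bullet> v = 0 \<and> w \<bullet> (\<i> *s v) = 0}"

definition legendrian :: "'a chart set \<Rightarrow> ('a \<Rightarrow> complex^3) \<Rightarrow> bool" where
  "legendrian C f \<longleftrightarrow> (\<forall>c\<in>C. \<forall>p \<in> fst c. range (dmap c f p) \<subseteq> contact_plane (f p))"

definition normal_part :: "'b::euclidean_space set \<Rightarrow> 'b \<Rightarrow> 'b" where
  "normal_part B w = w - closest_point (span B) w"

text \<open>
  Mean curvature vector in \<open>S\<^sup>5\<close> of an immersion: half the trace of the second fundamental form,
  i.e. of the part of the coordinate Hessian orthogonal to \<open>f, f\<^sub>x, f\<^sub>y\<close>, with respect to the
  induced metric.
\<close>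

definition mean_curvature :: "'a chart \<Rightarrow> ('a \<Rightarrow> complex^3) \<Rightarrow> 'a \<Rightarrow> complex^3" where
  "mean_curvature c f p =
     (let u = d_x c f p; v = d_y c f p; d = (u \<bullet> u) * (v \<bullet> v) - (u \<bullet> v)\<^sup>2
      in (1 / (2 * d)) *\<^sub>R normal_part {f p, u, v}
           ((v \<bullet> v) *\<^sub>R dmap2 c f p 1 1 - (2 * (u \<bullet> v)) *\<^sub>R dmap2 c f p 1 \<i> + (u \<bullet> u) *\<^sub>R dmap2 c f p \<i> \<i>))"

text \<open>
  Up to the conformal factor, the tension field of a map into \<open>S\<^sup>5\<close>: the part of the Laplacian
  tangent to the sphere.
\<close>

definition tension :: "'a chart \<Rightarrow> ('a \<Rightarrow> complex^3) \<Rightarrow> 'a \<Rightarrow> complex^3" where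
  "tension c f p = normal_part {f p} (dmap2 c f p 1 1 + dmap2 c f p \<i> \<i>)"

text \<open>
  Minimal maps of a Riemann surface into \<open>S\<^sup>5\<close>: (weakly) conformal, with vanishing mean curvature
  wherever they are immersions; harmonicity extends the latter condition over the points at which the
  differential vanishes.
\<close>

definition minimal_map :: "'a topology \<Rightarrow> 'a chart set \<Rightarrow> ('a \<Rightarrow> complex^3) \<Rightarrow> bool" where
  "minimal_map X C f \<longleftrightarrow> f ` topspace X \<subseteq> S5 \<and> smooth_map_on C (topspace X) f \<and>
     weakly_conformal C f \<and>
     (\<forall>c\<in>C. \<forall>p \<in> fst c. tension c f p = 0) \<and>
     (\<forall>c\<in>C. \<forall>p \<in> fst c \<inter> regular_points X C f. mean_curvature c f p = 0)"


section \<open>The flag manifold as a homogeneous space\<close>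

type_synonym flag_point = "(complex^3) \<times> oriented_plane"

definition FL1 :: "flag_point set" where
  "FL1 = {(v, V). v \<in> S5 \<and> V \<in> SL \<and> v \<in> underlying_plane V}"

definition pi1 :: "flag_point \<Rightarrow> complex^3" where
  "pi1 = fst"

definition pi2 :: "flag_point \<Rightarrow> oriented_plane" where
  "pi2 = snd"

text \<open>The quotient map of \<open>SU\<^sub>3\<close> onto \<open>FL1\<close>, i.e. \<open>g\<close> is sent to the coset \<open>g K\<^sub>1\<close>.\<close>

definition flag :: "complex^3^3 \<Rightarrow> flag_point" where
  "flag g = (g *v axis 1 1, act_plane g)"

text \<open>
  The manifold structure of \<open>FL1\<close> is that of the quotient \<open>SU\<^sub>3 / K\<^sub>1\<close>: a function on \<open>FL1\<close> is smooth
  iff its pull-back to the submanifold \<open>SU3\<close> of the matrix space is, i.e. iff that pull-back is the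
  restriction of a smooth function on a neighbourhood of \<open>SU3\<close>.  Elements of the complexified tangent
  spaces are complex valued derivations of this algebra of real functions.
\<close>

definition smooth_FL1 :: "(flag_point \<Rightarrow> real) set" where
  "smooth_FL1 = {h. \<exists>W H. open W \<and> SU3 \<subseteq> W \<and> smooth_on W H \<and> (\<forall>g\<in>SU3. h (flag g) = H g)}"

type_synonym tangent_FL1 = "(flag_point \<Rightarrow> real) \<Rightarrow> complex"

definition su3 :: "(complex^3^3) set" where
  "su3 = {X. herm_transpose X = - X \<and> trace X = 0}"

definition mat_exp :: "complex^3^3 \<Rightarrow> complex^3^3" where
  "mat_exp X = (\<Sum>n. (1 / fact n) *\<^sub>R ((\<lambda>Y. X ** Y) ^^ n) (mat 1))"

text \<open>The derivative at \<open>t = 0\<close> of \<open>h\<close> along the curve \<open>g e\<^sup>t\<^sup>X K\<^sub>1\<close>.\<close>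

definition curve_deriv :: "complex^3^3 \<Rightarrow> complex^3^3 \<Rightarrow> (flag_point \<Rightarrow> real) \<Rightarrow> real" where
  "curve_deriv g X h = deriv (\<lambda>t. h (flag (g ** mat_exp (t *\<^sub>R X)))) 0"

text \<open>
  Its complex linear extension to \<open>sl\<^sub>3(C)\<close>, evaluated at \<open>A + iB\<close> with \<open>A, B\<close> in \<open>su3\<close>; every
  element of \<open>sl\<^sub>3(C)\<close> is uniquely of this form.
\<close>

definition tangent_vector :: "complex^3^3 \<Rightarrow> complex^3^3 \<Rightarrow> complex^3^3 \<Rightarrow> tangent_FL1" where
  "tangent_vector g A B = (\<lambda>h\<in>smooth_FL1. Complex (curve_deriv g A h) (curve_deriv g B h))"

definition Rot :: "complex^3^3" where
  "Rot = vector [vector [1, 0, 0],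
                 vector [0, cos (of_real (pi/3)), sin (of_real (pi/3))],
                 vector [0, - sin (of_real (pi/3)), cos (of_real (pi/3))]]"

definition eps :: complex where
  "eps = exp (2 * of_real pi * \<i> / 3)"

definition ghat1 :: "(complex^3^3) set" where
  "ghat1 = {X. trace X = 0 \<and> - (Rot ** transpose X ** matrix_inv Rot) = mat (- eps) ** X}"

text \<open>The fibre of \<open>[ghat1]\<close> at the point \<open>q\<close> of \<open>FL1\<close>.\<close>

definition ghat1_fibre :: "flag_point \<Rightarrow> tangent_FL1 set" where
  "ghat1_fibre q = {tangent_vector g A B | g A B.
     g \<in> SU3 \<and> flag g = q \<and> A \<in> su3 \<and> B \<in> su3 \<and> A + mat \<i> ** B \<in> ghat1}"

definition smooth_immersion_FL1 ::
    "'a topology \<Rightarrow> 'a chart set \<Rightarrow> ('a \<Rightarrow> flag_point) \<Rightarrow> bool" where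
  "smooth_immersion_FL1 X C \<psi> \<longleftrightarrow> \<psi> ` topspace X \<subseteq> FL1 \<and>
     (\<forall>h\<in>smooth_FL1. smooth_map_on C (topspace X) (h \<circ> \<psi>)) \<and>
     (\<forall>c\<in>C. \<forall>p \<in> fst c. \<forall>w. w \<noteq> 0 \<longrightarrow> (\<exists>h\<in>smooth_FL1. dmap c (h \<circ> \<psi>) p w \<noteq> 0))"

text \<open>\<open>d\<psi>(\<partial>/\<partial>z)\<close>, with \<open>\<partial>/\<partial>z = (\<partial>/\<partial>x - i \<partial>/\<partial>y) / 2\<close>.\<close>

definition dpsi_dz :: "'a chart \<Rightarrow> ('a \<Rightarrow> flag_point) \<Rightarrow> 'a \<Rightarrow> tangent_FL1" where
  "dpsi_dz c \<psi> p =
     (\<lambda>h\<in>smooth_FL1. (of_real (d_x c (h \<circ> \<psi>) p) - \<i> * of_real (d_y c (h \<circ> \<psi>) p)) / 2)"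

text \<open>
  Primitive maps.  They are automatically harmonic for suitable invariant metrics on \<open>FL1\<close>, which is
  why they are called primitive harmonic; no further condition is implied by that name.
\<close>

definition primitive_harmonic ::
    "'a topology \<Rightarrow> 'a chart set \<Rightarrow> ('a \<Rightarrow> flag_point) \<Rightarrow> bool" where
  "primitive_harmonic X C \<psi> \<longleftrightarrow> smooth_immersion_FL1 X C \<psi> \<and>
     (\<forall>c\<in>C. \<forall>p \<in> fst c. dpsi_dz c \<psi> p \<in> ghat1_fibre (\<psi> p))"

end

theory Submission
  imports Defs
begin

text \<open>
  Everything is read off from the Maurer--Cartan form of one moving frame.  In a conformal coordinate
  \<open>z = x + iy\<close> let \<open>l\<close> be the norm of \<open>f\<^sub>x\<close> and let \<open>E\<close> be the matrix with columns \<open>f\<close>, \<open>f\<^sub>x / l\<close>, \<open>f\<^sub>y / l\<close>.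
  An oriented orthonormal basis of a plane in \<open>SL\<close> forms the columns of a matrix in \<open>SU3\<close>
  (\<open>orthonormal_frame_in_SU3\<close>).  So if the cone over \<open>f\<close> is special Lagrangian with Gauss map \<open>G\<close>, then \<open>E\<close>
  takes values in \<open>SU3\<close> and lifts the map \<open>(f, G)\<close>.
  
  The eigenspace \<open>ghat1\<close> consists of the matrices with rows \<open>0, a, -ia\<close> and \<open>-a, b, ib\<close> and \<open>ia, ib, -b\<close>.
  The first column of \<open>E\<inverse> dE\<close> is \<open>(0, l dx, l dy)\<close>, because \<open>dE e\<^sub>1 = df\<close>; its \<open>dz\<close> part therefore has the
  shape prescribed by \<open>a\<close>.  The remaining block is skew-Hermitian and traceless.  The identity
  \<open>f\<^sub>x\<^sub>y = f\<^sub>y\<^sub>x\<close>, written as \<open>\<partial>\<^sub>y (l E e\<^sub>2) = \<partial>\<^sub>x (l E e\<^sub>3)\<close>, gives two conditions on the imaginary part of the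
  block.  They say that its \<open>dz\<close> part has the shape prescribed by \<open>b\<close>, up to a multiple of the generator of
  \<open>K\<^sub>1\<close>, which is invisible in the quotient.  So \<open>(f, G)\<close> is primitive.  The real part of the same identity
  computes \<open>dl\<close>, and together they give \<open>f\<^sub>x\<^sub>x + f\<^sub>y\<^sub>y = - 2 l\<^sup>2 f\<close>, that is, minimality.  Both facts are
  contained in \<open>structure_equations\<close>.
  
  Conversely, let \<open>\<psi>\<close> be primitive and \<open>f\<close> its projection to the sphere.  By reality, the shape of the
  first column of the eigenspace says that \<open>f\<^sub>x\<close> and \<open>f\<^sub>y\<close> are \<open>s g e\<^sub>2 + t g e\<^sub>3\<close> and its rotation
  \<open>- t g e\<^sub>2 + s g e\<^sub>3\<close>, where \<open>\<psi>\<close> is the flag of \<open>g\<close> (\<open>primitive_derivatives\<close>).  Hence \<open>f\<close> is conformal and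
  Legendrian, and where \<open>(s, t)\<close> is nonzero the cone over \<open>f\<close> has tangent plane \<open>g (e\<^sub>1 \<and> e\<^sub>2 \<and> e\<^sub>3)\<close>.  There
  the structure equations apply and give minimality.  The Laplacian remains a multiple of \<open>f\<close> at the
  critical points: on the interior of the critical set it vanishes, and elsewhere continuity suffices
  (\<open>laplacian_in_span\<close>).
\<close>

section \<open>Calculus of iterated directional derivatives\<close>

lemma Ck_on_Suc_iff:
  "Ck_on (Suc k) S f \<longleftrightarrow>
     (\<forall>x\<in>S. (f has_derivative frechet_derivative f (at x)) (at x)) \<and>
     (\<forall>v. Ck_on k S (\<lambda>x. frechet_derivative f (at x) v))"
  by (simp add: frechet_derivative_works)

lemma Ck_on_transform:
  assumes "open S" "Ck_on k S f" "\<And>x. x \<in> S \<Longrightarrow> f x = g x"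
  shows "Ck_on k S g"
  using assms(2,3)
proof (induction k arbitrary: f g)
  case 0
  then show ?case
    using continuous_on_cong[of S S f g] by simp
next
  case (Suc k)
  have fg: "frechet_derivative f (at x) = frechet_derivative g (at x)" if "x \<in> S" for x
    using frechet_derivative_transform_within_open[of f x S g] Suc.prems that assms(1) by auto
  have "g differentiable (at x)" if "x \<in> S" for x
  proof -
    have "(f has_derivative frechet_derivative f (at x)) (at x)"
      using Suc.prems(1) that by (simp add: frechet_derivative_works)
    then have "(g has_derivative frechet_derivative f (at x)) (at x)"
      using assms(1) that Suc.prems(2) by (rule has_derivative_transform_within_open)
    then show ?thesis
      by (rule differentiableI)
  qed
  moreover have "Ck_on k S (\<lambda>x. frechet_derivative g (at x) v)" for v
    using Suc.prems(1) by (rule_tac Suc.IH[of "\<lambda>x. frechet_derivative f (at x) v"])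
        (simp_all add: fg)
  ultimately show ?case
    by simp
qed

text \<open>
  On an open set any formula for the derivative may replace the chosen one in the recursion, so that
  each closure property below is an induction on \<open>k\<close> over its own differentiation rule.
\<close>

lemma Ck_on_SucI:
  assumes "open S" "\<And>x. x \<in> S \<Longrightarrow> (f has_derivative D x) (at x)"
    and "\<And>v. Ck_on k S (\<lambda>x. D x v)"
  shows "Ck_on (Suc k) S f"
proof -
  have "frechet_derivative f (at x) = D x" if "x \<in> S" for x
    using assms(2)[OF that] frechet_derivative_at by metis
  then show ?thesis
    using assms by (auto intro: differentiableI Ck_on_transform[OF assms(1) assms(3)])
qed

lemma Ck_on_lower: "Ck_on (Suc k) S f \<Longrightarrow> Ck_on k S f"
proof (induction k arbitrary: f)
  case 0
  then show ?case
    by (auto intro!: continuous_at_imp_continuous_on differentiable_imp_continuous_within)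
next
  case (Suc k)
  then show ?case
    by (meson Ck_on.simps(2))
qed

lemma Ck_on_subset: "Ck_on k S f \<Longrightarrow> T \<subseteq> S \<Longrightarrow> Ck_on k T f"
  by (induction k arbitrary: f) (auto intro: continuous_on_subset)

text \<open>
  Smoothness in a conformal coordinate will only be known near each point, on the overlaps with the
  charts of a second atlas.
\<close>

lemma Ck_on_local:
  assumes "\<And>x. x \<in> S \<Longrightarrow> \<exists>T. open T \<and> x \<in> T \<and> Ck_on k T f"
  shows "Ck_on k S f"
  using assms
proof (induction k arbitrary: f)
  case 0
  then show ?case
    by (metis Ck_on.simps(1) continuous_at_imp_continuous_on continuous_on_eq_continuous_at)
next
  case (Suc k)
  then show ?case
    by (metis Ck_on.simps(2))
qed

lemma Ck_on_const: "open S \<Longrightarrow> Ck_on k S (\<lambda>x. c)"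
  by (induction k arbitrary: c) auto

lemma Ck_on_linear_image:
  assumes "open S" "bounded_linear T" "Ck_on k S f"
  shows "Ck_on k S (\<lambda>x. T (f x))"
  using assms(3)
proof (induction k arbitrary: f)
  case 0
  then show ?case
    using assms(2) by (simp add: bounded_linear.continuous_on)
next
  case (Suc k)
  show ?case
  proof (rule Ck_on_SucI[OF assms(1)])
    show "((\<lambda>x. T (f x)) has_derivative (\<lambda>v. T (frechet_derivative f (at x) v))) (at x)"
      if "x \<in> S" for x
      using Suc.prems that assms(2) unfolding Ck_on_Suc_iff
      by (blast intro: bounded_linear.has_derivative)
    show "Ck_on k S (\<lambda>x. T (frechet_derivative f (at x) v))" for v
      using Suc.prems by (intro Suc.IH) simp_all
  qed
qed

lemma Ck_on_bounded_linear: "open S \<Longrightarrow> bounded_linear T \<Longrightarrow> Ck_on k S T"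
proof (cases k)
  case 0
  then show "bounded_linear T \<Longrightarrow> Ck_on k S T"
    by (simp add: linear_continuous_on)
next
  case (Suc m)
  assume "open S" "bounded_linear T"
  then show "Ck_on k S T"
    unfolding Suc by (intro Ck_on_SucI[where D = "\<lambda>_. T"])
      (auto intro: bounded_linear_imp_has_derivative Ck_on_const)
qed

lemma Ck_on_add:
  assumes "open S" "Ck_on k S f" "Ck_on k S g"
  shows "Ck_on k S (\<lambda>x. f x + g x)"
  using assms(2,3)
proof (induction k arbitrary: f g)
  case 0
  then show ?case
    by (simp add: continuous_on_add)
next
  case (Suc k)
  show ?case
  proof (rule Ck_on_SucI[OF assms(1)])
    show "((\<lambda>x. f x + g x) has_derivative
        (\<lambda>v. frechet_derivative f (at x) v + frechet_derivative g (at x) v)) (at x)"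
            if "x \<in> S" for x
      using Suc.prems that unfolding Ck_on_Suc_iff by (blast intro: has_derivative_add)
    show "Ck_on k S (\<lambda>x. frechet_derivative f (at x) v + frechet_derivative g (at x) v)" for v
      using Suc.prems by (intro Suc.IH) simp_all
  qed
qed

lemma Ck_on_sum:
  assumes "open S" "finite I" "\<And>i. i \<in> I \<Longrightarrow> Ck_on k S (f i)"
  shows "Ck_on k S (\<lambda>x. \<Sum>i\<in>I. f i x)"
  using assms(2,3) by (induction rule: finite_induct) (auto intro: Ck_on_const Ck_on_add assms(1))

lemma Ck_on_bilinear:
  assumes "open S" "bounded_bilinear B" "Ck_on k S f" "Ck_on k S g"
  shows "Ck_on k S (\<lambda>x. B (f x) (g x))"
  using assms(3,4)
proof (induction k arbitrary: f g)
  case 0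
  then show ?case
    using assms(2) by (simp add: bounded_bilinear.continuous_on)
next
  case (Suc k)
  show ?case
  proof (rule Ck_on_SucI[OF assms(1)])
    show "((\<lambda>x. B (f x) (g x)) has_derivative
        (\<lambda>v. B (f x) (frechet_derivative g (at x) v) + B (frechet_derivative f (at x) v) (g x))) (at x)"
      if "x \<in> S" for x
      using Suc.prems that assms(2) unfolding Ck_on_Suc_iff by (blast intro: bounded_bilinear.FDERIV)
    show "Ck_on k S
        (\<lambda>x. B (f x) (frechet_derivative g (at x) v) + B (frechet_derivative f (at x) v) (g x))" for v
      using Suc.prems Ck_on_lower[OF Suc.prems(1)] Ck_on_lower[OF Suc.prems(2)]
      by (intro Ck_on_add[OF assms(1)] Suc.IH) simp_all
  qed
qed

text \<open>
  Expanding the inner derivative in the basis turns the chain rule into a sum of products of a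
  component of \<open>dg\<close> with a directional derivative of \<open>f\<close> composed with \<open>g\<close>, to which the induction
  hypothesis applies.
\<close>

lemma Ck_on_compose:
  fixes g :: "'a::real_normed_vector \<Rightarrow> 'b::euclidean_space"
  assumes "open S" "g ` S \<subseteq> T" "Ck_on k S g" "Ck_on k T f"
  shows "Ck_on k S (\<lambda>x. f (g x))"
  using assms(3,4)
proof (induction k arbitrary: f)
  case 0
  then show ?case
    using assms(2) by (auto intro: continuous_on_compose2)
next
  case (Suc k)
  show ?case
  proof (rule Ck_on_SucI[OF assms(1)])
    fix x assume x: "x \<in> S"
    let ?Df = "frechet_derivative f (at (g x))" and ?Dg = "frechet_derivative g (at x)"
    have Df: "(f has_derivative ?Df) (at (g x))" and Dg: "(g has_derivative ?Dg) (at x)"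
      using Suc.prems x assms(2) unfolding Ck_on_Suc_iff by blast+
    have "?Df (?Dg v) = (\<Sum>b\<in>Basis. (?Dg v \<bullet> b) *\<^sub>R ?Df b)" for v
    proof -
      have "?Df (?Dg v) = ?Df (\<Sum>b\<in>Basis. (?Dg v \<bullet> b) *\<^sub>R b)"
        by (simp add: euclidean_representation)
      also have "\<dots> = (\<Sum>b\<in>Basis. (?Dg v \<bullet> b) *\<^sub>R ?Df b)"
        using has_derivative_linear[OF Df] by (simp add: linear_sum linear_scale)
      finally show ?thesis .
    qed
    then show "((\<lambda>x. f (g x)) has_derivative
        (\<lambda>v. \<Sum>b\<in>Basis. (?Dg v \<bullet> b) *\<^sub>R ?Df b)) (at x)"
      using diff_chain_at[OF Dg Df] by (simp add: o_def)
  next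
    fix v
    have "Ck_on k S (\<lambda>x. frechet_derivative g (at x) v \<bullet> b)" for b
      using Suc.prems(1) by (intro Ck_on_linear_image[OF assms(1) bounded_linear_inner_left]) auto
    moreover have "Ck_on k S (\<lambda>x. frechet_derivative f (at (g x)) b)" for b
      using Suc.IH[OF Ck_on_lower[OF Suc.prems(1)]] Suc.prems(2) by auto
    ultimately show "Ck_on k S (\<lambda>x. \<Sum>b\<in>Basis. (frechet_derivative g (at x) v \<bullet> b) *\<^sub>R
        frechet_derivative f (at (g x)) b)"
      by (intro Ck_on_sum assms(1) Ck_on_bilinear[OF assms(1) bounded_bilinear_scaleR]) auto
  qed
qed

lemma Ck_on_componentwise:
  fixes f :: "'a::real_normed_vector \<Rightarrow> 'b::euclidean_space"
  assumes "open S" "\<And>b. b \<in> Basis \<Longrightarrow> Ck_on k S (\<lambda>x. f x \<bullet> b)"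
  shows "Ck_on k S f"
proof -
  have "Ck_on k S (\<lambda>x. \<Sum>b\<in>Basis. (f x \<bullet> b) *\<^sub>R b)"
    using assms by (intro Ck_on_sum Ck_on_linear_image[OF assms(1) bounded_linear_scaleR_left]) auto
  then show ?thesis
    by (simp add: euclidean_representation)
qed

text \<open>
  The derivative of \<open>u = 1 / |f|\<close> is \<open>- u\<^sup>3 (f \<bullet> df)\<close>, again an expression in \<open>u\<close> and derivatives
  of \<open>f\<close>; this closes the induction without any appeal to smoothness of the square root.
\<close>

lemma Ck_on_inverse_norm:
  fixes f :: "'a::real_normed_vector \<Rightarrow> 'b::real_inner"
  assumes "open S" "\<And>x. x \<in> S \<Longrightarrow> f x \<noteq> 0" "Ck_on k S f"
  shows "Ck_on k S (\<lambda>x. inverse (norm (f x)))"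
  using assms(3)
proof (induction k)
  case 0
  then show ?case
    using assms(2) by (auto intro!: continuous_intros)
next
  case (Suc k)
  define u where "u x = inverse (norm (f x))" for x
  define D where "D x v = (f x \<bullet> frechet_derivative f (at x) v) * (- (u x * (u x * u x)))" for x v
  have "Ck_on k S u"
    using Suc.IH[OF Ck_on_lower[OF Suc.prems]] by (simp add: u_def[abs_def])
  note times = Ck_on_bilinear[OF assms(1) bounded_bilinear_mult]
  have "Ck_on (Suc k) S u"
  proof (rule Ck_on_SucI[OF assms(1)])
    fix x assume x: "x \<in> S"
    have "(f has_derivative frechet_derivative f (at x)) (at x)"
      using Suc.prems x unfolding Ck_on_Suc_iff by blast
    note df = this
    have "((\<lambda>x. norm (f x)) has_derivative
        (\<lambda>v. frechet_derivative f (at x) v \<bullet> sgn (f x))) (at x)"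
      by (rule has_derivative_compose[OF df GDERIV_norm[OF assms(2)[OF x], unfolded gderiv_def]])
    from Deriv.has_derivative_inverse[OF _ this]
    have "(u has_derivative
        (\<lambda>v. - (inverse (norm (f x)) * (frechet_derivative f (at x) v \<bullet> sgn (f x)) *
              inverse (norm (f x))))) (at x)"
      unfolding u_def[abs_def] using assms(2)[OF x] by (simp add: mult.commute mult.left_commute)
    moreover have "(\<lambda>v. - (inverse (norm (f x)) * (frechet_derivative f (at x) v \<bullet> sgn (f x)) *
              inverse (norm (f x)))) = D x"
      by (simp add: fun_eq_iff D_def u_def sgn_div_norm inner_commute mult.assoc mult.left_commute
          mult.commute)
    ultimately show "(u has_derivative D x) (at x)"
      by simp
  next
    fix v
    have "Ck_on k S (\<lambda>x. - (u x * (u x * u x)))"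
      using \<open>Ck_on k S u\<close>
      by (intro Ck_on_linear_image[OF assms(1) bounded_linear_minus[OF bounded_linear_ident]] times)
    moreover have "Ck_on k S (\<lambda>x. f x \<bullet> frechet_derivative f (at x) v)"
      using Suc.prems Ck_on_lower[OF Suc.prems]
      by (intro Ck_on_bilinear[OF assms(1) bounded_bilinear_inner]) auto
    ultimately show "Ck_on k S (\<lambda>x. D x v)"
      unfolding D_def by (intro times)
  qed
  then show ?case
    by (simp add: u_def[abs_def])
qed

lemma smooth_on_has_derivative:
  "smooth_on S f \<Longrightarrow> x \<in> S \<Longrightarrow> (f has_derivative frechet_derivative f (at x)) (at x)"
  unfolding smooth_on_def using Ck_on_Suc_iff by blast

lemma smooth_on_derivative: "smooth_on S f \<Longrightarrow> smooth_on S (\<lambda>x. frechet_derivative f (at x) v)"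
  unfolding smooth_on_def by (metis Ck_on.simps(2))

lemma smooth_on_continuous_on: "smooth_on S f \<Longrightarrow> continuous_on S f"
  unfolding smooth_on_def by (metis Ck_on.simps(1))

section \<open>Symmetry of second derivatives\<close>

text \<open>
  The second difference is the increment from \<open>0\<close> to \<open>h\<close> of \<open>s \<mapsto> \<phi> (z + s u + h v) - \<phi> (z + s u)\<close>.  The mean
  value theorem in \<open>s\<close>, and then in \<open>t\<close> for \<open>D\<^sub>u \<phi>\<close>, produces the second derivative.
\<close>

lemma second_difference_mean_value:
  fixes \<phi> :: "'a::real_normed_vector \<Rightarrow> real"
  assumes \<phi>: "smooth_on U \<phi>" and h: "0 < h"
    and U: "\<And>s t. 0 \<le> s \<Longrightarrow> s \<le> h \<Longrightarrow> 0 \<le> t \<Longrightarrow> t \<le> h \<Longrightarrow> z + s *\<^sub>R u + t *\<^sub>R v \<in> U"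
  obtains s t where "0 < s" "s < h" "0 < t" "t < h"
    "\<phi> (z + h *\<^sub>R u + h *\<^sub>R v) - \<phi> (z + h *\<^sub>R u) - \<phi> (z + h *\<^sub>R v) + \<phi> z =
       h\<^sup>2 * frechet_derivative (\<lambda>x. frechet_derivative \<phi> (at x) u) (at (z + s *\<^sub>R u + t *\<^sub>R v)) v"
proof -
  define D where "D x = frechet_derivative \<phi> (at x)" for x
  define D2 where "D2 x = frechet_derivative (\<lambda>x. D x u) (at x)" for x
  define q where "q s = \<phi> (z + s *\<^sub>R u + h *\<^sub>R v) - \<phi> (z + s *\<^sub>R u)" for s
  have D: "(\<phi> has_derivative D x) (at x)" if "x \<in> U" for x
    unfolding D_def using \<phi> that by (rule smooth_on_has_derivative)
  have D2: "((\<lambda>x. D x u) has_derivative D2 x) (at x)" if "x \<in> U" for x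
    unfolding D_def D2_def using smooth_on_derivative[OF \<phi>] that by (rule smooth_on_has_derivative)
  have dq: "(q has_real_derivative (D (z + s *\<^sub>R u + h *\<^sub>R v) u - D (z + s *\<^sub>R u) u)) (at s)"
    if "0 \<le> s" "s \<le> h" for s
  proof -
    have 1: "((\<lambda>s. \<phi> (z + s *\<^sub>R u + t *\<^sub>R v)) has_derivative (\<lambda>r. D (z + s *\<^sub>R u + t *\<^sub>R v) (r *\<^sub>R u))) (at s)"
      if "z + s *\<^sub>R u + t *\<^sub>R v \<in> U" for t
      using that by (intro has_derivative_compose[where f = "\<lambda>s. z + s *\<^sub>R u + t *\<^sub>R v" and g = \<phi>] D)
        (auto intro!: derivative_eq_intros)
    have 2: "D x (r *\<^sub>R u) = r * D x u" if "x \<in> U" for x r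
      using D[OF that] by (simp add: has_derivative_linear linear_scale)
    have U1: "z + s *\<^sub>R u + h *\<^sub>R v \<in> U"
        and U0: "z + s *\<^sub>R u + 0 *\<^sub>R v \<in> U"
      using U[of s h] U[of s 0] that h by auto
    have "(q has_derivative (\<lambda>r. D (z + s *\<^sub>R u + h *\<^sub>R v) (r *\<^sub>R u) - D (z + s *\<^sub>R u) (r *\<^sub>R u))) (at s)"
      using has_derivative_diff[OF 1[OF U1] 1[OF U0]] by (simp add: q_def[abs_def])
    moreover have "(\<lambda>r. D (z + s *\<^sub>R u + h *\<^sub>R v) (r *\<^sub>R u) - D (z + s *\<^sub>R u) (r *\<^sub>R u)) =
        (*) (D (z + s *\<^sub>R u + h *\<^sub>R v) u - D (z + s *\<^sub>R u) u)"
      using 2[OF U1] 2[OF U0] by (auto simp: fun_eq_iff algebra_simps)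
    ultimately show ?thesis
      by (simp add: has_field_derivative_def)
  qed
  obtain s where s: "0 < s" "s < h"
      and qs: "q h - q 0 = h * (D (z + s *\<^sub>R u + h *\<^sub>R v) u - D (z + s *\<^sub>R u) u)"
    using MVT2[OF h, of q "\<lambda>s. D (z + s *\<^sub>R u + h *\<^sub>R v) u - D (z + s *\<^sub>R u) u"] dq by auto
  have dt: "((\<lambda>t. D (z + s *\<^sub>R u + t *\<^sub>R v) u) has_real_derivative D2 (z + s *\<^sub>R u + t *\<^sub>R v) v) (at t)"
    if "0 \<le> t" "t \<le> h" for t
  proof -
    have inU: "z + s *\<^sub>R u + t *\<^sub>R v \<in> U"
      using U s that by simp
    have "((\<lambda>t. D (z + s *\<^sub>R u + t *\<^sub>R v) u) has_derivative (\<lambda>r. D2 (z + s *\<^sub>R u + t *\<^sub>R v) (r *\<^sub>R v))) (at t)"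
      using inU by (intro has_derivative_compose[where f = "\<lambda>t. z + s *\<^sub>R u + t *\<^sub>R v" and g = "\<lambda>x. D x u"] D2)
        (auto intro!: derivative_eq_intros)
    moreover have "D2 (z + s *\<^sub>R u + t *\<^sub>R v) (r *\<^sub>R v) = D2 (z + s *\<^sub>R u + t *\<^sub>R v) v * r" for r
      using D2[OF inU] by (simp add: has_derivative_linear linear_scale)
    ultimately show ?thesis
      by (simp add: has_field_derivative_def)
  qed
  obtain t where t: "0 < t" "t < h"
    and ts: "D (z + s *\<^sub>R u + h *\<^sub>R v) u - D (z + s *\<^sub>R u + 0 *\<^sub>R v) u = h * D2 (z + s *\<^sub>R u + t *\<^sub>R v) v"
    using MVT2[OF h, of "\<lambda>t. D (z + s *\<^sub>R u + t *\<^sub>R v) u"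
        "\<lambda>t. D2 (z + s *\<^sub>R u + t *\<^sub>R v) v"] dt
    by auto
  have "q h - q 0 = h\<^sup>2 * D2 (z + s *\<^sub>R u + t *\<^sub>R v) v"
    using qs ts by (simp add: power2_eq_square)
  then show thesis
    using that[OF s t] by (simp add: q_def D2_def D_def algebra_simps)
qed

text \<open>
  The second difference is symmetric in \<open>u\<close> and \<open>v\<close>; letting \<open>h\<close> tend to \<open>0\<close> in its two mean value
  representations identifies the two mixed derivatives.
\<close>

lemma mixed_derivatives_real:
  fixes \<phi> :: "'a::real_normed_vector \<Rightarrow> real"
  assumes \<phi>: "smooth_on U \<phi>" and U: "open U" "z \<in> U"
  shows "frechet_derivative (\<lambda>x. frechet_derivative \<phi> (at x) u) (at z) v =
         frechet_derivative (\<lambda>x. frechet_derivative \<phi> (at x) v) (at z) u"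
proof -
  define D2 where "D2 u v x = frechet_derivative (\<lambda>x. frechet_derivative \<phi> (at x) u) (at x) v" for u v x
  have cont: "continuous (at z) (D2 u v)" for u v
    unfolding D2_def
    using smooth_on_continuous_on[OF smooth_on_derivative[OF smooth_on_derivative[OF \<phi>]]] U
      continuous_on_eq_continuous_at by blast
  have close: "\<bar>D2 u v z - D2 v u z\<bar> < 2 * e" if "e > 0" for e
  proof -
    obtain d1 where d1: "d1 > 0"
        "\<And>x. dist x z < d1 \<Longrightarrow> dist (D2 u v x) (D2 u v z) < e"
      using cont[of u v] \<open>e > 0\<close> unfolding continuous_at_eps_delta by metis
    obtain d2 where d2: "d2 > 0"
        "\<And>x. dist x z < d2 \<Longrightarrow> dist (D2 v u x) (D2 v u z) < e"
      using cont[of v u] \<open>e > 0\<close> unfolding continuous_at_eps_delta by metis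
    obtain d3 where d3: "d3 > 0" "\<And>x. dist x z < d3 \<Longrightarrow> x \<in> U"
      using U by (meson open_dist)
    define d where "d = min d1 (min d2 d3)"
    define h where "h = d / (2 * (norm u + norm v + 1))"
    have d: "d > 0"
      using d1 d2 d3 by (simp add: d_def)
    have h: "h > 0"
      using d by (simp add: h_def add_nonneg_pos)
    have near: "dist (z + s *\<^sub>R u + t *\<^sub>R v) z < d"
        if "0 \<le> s" "s \<le> h" "0 \<le> t" "t \<le> h" for s t
    proof -
      have "dist (z + s *\<^sub>R u + t *\<^sub>R v) z \<le> s * norm u + t * norm v"
        using norm_triangle_ineq[of "s *\<^sub>R u" "t *\<^sub>R v"] that by (simp add: dist_norm)
      also have "\<dots> \<le> h * norm u + h * norm v"
        using that by (intro add_mono mult_right_mono) auto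
      also have "\<dots> < h * (2 * (norm u + norm v + 1))"
        using h unfolding distrib_left[symmetric] by (intro mult_strict_left_mono)
            (auto simp: add_nonneg_pos)
      also have "\<dots> = d"
        unfolding h_def by (simp add: add_nonneg_eq_0_iff)
      finally show ?thesis .
    qed
    have inU: "z + s *\<^sub>R u + t *\<^sub>R v \<in> U" "z + s *\<^sub>R v + t *\<^sub>R u \<in> U"
      if "0 \<le> s" "s \<le> h" "0 \<le> t" "t \<le> h" for s t
      using near[OF that] near[OF that(3,4,1,2)] d3(2) by (auto simp: d_def add_ac)
    obtain s t where st: "0 < s" "s < h" "0 < t" "t < h"
      and eq1: "\<phi> (z + h *\<^sub>R u + h *\<^sub>R v) - \<phi> (z + h *\<^sub>R u) - \<phi> (z + h *\<^sub>R v) + \<phi> z =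
        h\<^sup>2 * D2 u v (z + s *\<^sub>R u + t *\<^sub>R v)"
      unfolding D2_def by (rule second_difference_mean_value[OF \<phi> h inU(1)])
    obtain s' t' where st': "0 < s'" "s' < h" "0 < t'" "t' < h"
      and eq2: "\<phi> (z + h *\<^sub>R v + h *\<^sub>R u) - \<phi> (z + h *\<^sub>R v) - \<phi> (z + h *\<^sub>R u) + \<phi> z =
        h\<^sup>2 * D2 v u (z + s' *\<^sub>R v + t' *\<^sub>R u)"
      unfolding D2_def by (rule second_difference_mean_value[OF \<phi> h inU(2)])
    have comm: "z + h *\<^sub>R u + h *\<^sub>R v = z + h *\<^sub>R v + h *\<^sub>R u"
      by simp
    have "h\<^sup>2 * D2 u v (z + s *\<^sub>R u + t *\<^sub>R v) = h\<^sup>2 * D2 v u (z + s' *\<^sub>R v + t' *\<^sub>R u)"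
      using eq1 eq2 unfolding comm by linarith
    then have same: "D2 u v (z + s *\<^sub>R u + t *\<^sub>R v) = D2 v u (z + s' *\<^sub>R v + t' *\<^sub>R u)"
      using h by simp
    have "dist (z + s *\<^sub>R u + t *\<^sub>R v) z < d"
        "dist (z + s' *\<^sub>R v + t' *\<^sub>R u) z < d"
      using near[of s t] near[of t' s'] st st' by (auto simp: add_ac)
    then have "dist (D2 u v (z + s *\<^sub>R u + t *\<^sub>R v)) (D2 u v z) < e"
      "dist (D2 v u (z + s' *\<^sub>R v + t' *\<^sub>R u)) (D2 v u z) < e"
      using d1(2) d2(2) by (auto simp: d_def)
    then show ?thesis
      using same by (simp add: dist_real_def)
  qed
  have "D2 u v z = D2 v u z"
    using close[of "\<bar>D2 u v z - D2 v u z\<bar> / 2"] by fastforce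
  then show ?thesis
    by (simp add: D2_def)
qed

lemma frechet_derivative_inner:
  assumes "(F has_derivative D) (at x)"
  shows "frechet_derivative (\<lambda>x. F x \<bullet> b) (at x) v = D v \<bullet> b"
  using frechet_derivative_at[OF has_derivative_inner_left[OF assms]] by metis

lemma mixed_derivatives_commute:
  fixes F :: "'a::real_normed_vector \<Rightarrow> 'b::euclidean_space"
  assumes F: "smooth_on U F" and U: "open U" "z \<in> U"
  shows "frechet_derivative (\<lambda>x. frechet_derivative F (at x) u) (at z) v =
         frechet_derivative (\<lambda>x. frechet_derivative F (at x) v) (at z) u"
proof (rule euclidean_eqI)
  fix b :: 'b
  define \<phi> where "\<phi> x = F x \<bullet> b" for x
  have sm: "smooth_on U \<phi>"
    using F Ck_on_linear_image[OF U(1) bounded_linear_inner_left] unfolding smooth_on_def \<phi>_def by blast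
  have inner: "frechet_derivative (\<lambda>x. frechet_derivative F (at x) u) (at z) v \<bullet> b =
      frechet_derivative (\<lambda>x. frechet_derivative \<phi> (at x) u) (at z) v" for u v
  proof -
    have "frechet_derivative (\<lambda>x. frechet_derivative F (at x) u) (at z) v \<bullet> b =
        frechet_derivative (\<lambda>x. frechet_derivative F (at x) u \<bullet> b) (at z) v"
      using frechet_derivative_inner[OF smooth_on_has_derivative[OF smooth_on_derivative[OF F] U(2)]]
      by simp
    also have "(\<lambda>x. frechet_derivative F (at x) u \<bullet> b) differentiable at z"
      by (rule differentiableI[OF has_derivative_inner_left[OF
            smooth_on_has_derivative[OF smooth_on_derivative[OF F] U(2)]]])
    then have "frechet_derivative (\<lambda>x. frechet_derivative F (at x) u \<bullet> b) (at z) =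
        frechet_derivative (\<lambda>x. frechet_derivative \<phi> (at x) u) (at z)"
      using frechet_derivative_inner[OF smooth_on_has_derivative[OF F]]
      by (intro frechet_derivative_transform_within_open[OF _ U]) (auto simp: \<phi>_def[abs_def])
    finally show ?thesis .
  qed
  show "frechet_derivative (\<lambda>x. frechet_derivative F (at x) u) (at z) v \<bullet> b =
      frechet_derivative (\<lambda>x. frechet_derivative F (at x) v) (at z) u \<bullet> b"
    unfolding inner by (rule mixed_derivatives_real[OF sm U])
qed

section \<open>Unitary frames and oriented planes\<close>

text \<open>
  The real part is the Euclidean inner product and the imaginary part the Kaehler form, so that
  orthonormality, the Legendrian and the Lagrangian conditions are all statements about \<open>hdot\<close>.
\<close>

definition hdot :: "complex^3 \<Rightarrow> complex^3 \<Rightarrow> complex" where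
  "hdot u v = (\<Sum>i\<in>UNIV. cnj (u $ i) * v $ i)"

lemma bounded_bilinear_hdot: "bounded_bilinear hdot"
  unfolding bilinear_conv_bounded_bilinear[symmetric] bilinear_def
  by (auto intro!: linearI simp: hdot_def sum_3 scaleR_conv_of_real[where 'a = complex] algebra_simps)

interpretation hdot: bounded_bilinear hdot
  by (rule bounded_bilinear_hdot)

lemma cnj_hdot: "cnj (hdot u v) = hdot v u"
  by (simp add: hdot_def sum_3 mult.commute)

lemma Re_hdot: "Re (hdot u v) = u \<bullet> v"
  by (simp add: hdot_def sum_3 inner_vec_def inner_complex_def)

lemma hdot_self: "hdot v v = of_real ((norm v)\<^sup>2)"
  using cnj_hdot[of v v] Re_hdot[of v v] by (simp add: complex_eq_iff power2_norm_eq_inner)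

lemma contact_plane_iff: "w \<in> contact_plane v \<longleftrightarrow> hdot v w = 0"
  by (auto simp: contact_plane_def hdot_def sum_3 inner_vec_def inner_complex_def complex_eq_iff algebra_simps)

lemma herm_mult_nth: "(herm_transpose g ** h) $ i $ j = hdot (column i g) (column j h)"
  by (simp add: matrix_matrix_mult_def herm_transpose_def hdot_def column_def)

lemma unitary_iff:
  "herm_transpose g ** g = mat 1 \<longleftrightarrow>
     (\<forall>i j. hdot (column i g) (column j g) = (if i = j then 1 else 0))"
  by (simp add: vec_eq_iff[of "herm_transpose g ** g"] vec_eq_iff[of "_ :: complex^3"] herm_mult_nth mat_def)

lemma SU3_columns: "g \<in> SU3 \<Longrightarrow> hdot (column i g) (column j g) = (if i = j then 1 else 0)"
  by (simp add: SU3_def unitary_iff)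

lemma SU3_right_inverse: "g \<in> SU3 \<Longrightarrow> g ** herm_transpose g = mat 1"
  by (simp add: SU3_def matrix_left_right_inverse)

lemma det_herm_transpose: "det (herm_transpose X) = cnj (det X)"
  by (simp add: det_3 herm_transpose_def algebra_simps)

text \<open>The matrix with the given columns.\<close>

definition frame :: "complex^3 \<Rightarrow> complex^3 \<Rightarrow> complex^3 \<Rightarrow> complex^3^3" where
  "frame u v w = (\<chi> i j. if j = 1 then u $ i else if j = 2 then v $ i else w $ i)"

lemma column_frame [simp]:
  "column 1 (frame u v w) = u" "column 2 (frame u v w) = v" "column 3 (frame u v w) = w"
  by (simp_all add: frame_def column_def vec_eq_iff)

lemma frame_columns: "frame (column 1 g) (column 2 g) (column 3 g) = g"
  by (simp add: frame_def column_def vec_eq_iff forall_3)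

lemma mult_axis: "(g :: complex^3^3) *v axis k 1 = column k g"
  by (simp add: matrix_vector_mult_def column_def axis_def vec_eq_iff if_distrib cong: if_cong)

lemma flag_eq: "flag g = (column 1 g, oplane (column 1 g) (column 2 g) (column 3 g))"
  by (simp add: flag_def act_plane_def mult_axis)

lemma SL_iff:
  "V \<in> SL \<longleftrightarrow> (\<exists>g\<in>SU3. V = oplane (column 1 g) (column 2 g) (column 3 g))"
  by (auto simp: SL_def act_plane_def mult_axis)

text \<open>
  Real matrices act on triples of vectors stored as rows; oriented planes are orbits of the matrices of
  positive determinant.
\<close>

definition real_comb :: "real^3^3 \<Rightarrow> complex^3^3 \<Rightarrow> complex^3^3" where
  "real_comb A V = (\<chi> i. \<Sum>j\<in>UNIV. A $ i $ j *\<^sub>R V $ j)"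

lemma real_comb_mult: "real_comb (A ** B) V = real_comb A (real_comb B V)"
  by (simp add: real_comb_def vec_eq_iff matrix_matrix_mult_def sum_3 algebra_simps)

lemma real_comb_one: "real_comb (mat 1) V = V"
  by (simp add: real_comb_def vec_eq_iff[of "vec_lambda _"] mat_def sum_3 forall_3)

lemma oplane_real_comb: "oplane v1 v2 v3 = {real_comb A (vector [v1, v2, v3]) | A. det A > 0}"
  unfolding oplane_def real_comb_def vec_eq_iff[of _ "vec_lambda _"] by (auto simp: sum_3)

lemma basis_in_oplane: "vector [v1, v2, v3] \<in> oplane v1 v2 v3"
  unfolding oplane_real_comb using real_comb_one det_I
  by (metis (mono_tags, lifting) mem_Collect_eq zero_less_one)

lemma oplane_basis_change:
  assumes B: "det B > 0" and "vector [w1, w2, w3] = real_comb B (vector [v1, v2, v3])"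
  shows "oplane w1 w2 w3 = oplane v1 v2 v3"
proof -
  let ?V = "vector [v1, v2, v3] :: complex^3^3"
  obtain C where C: "C ** B = mat 1"
    using B by (metis invertible_det_nz invertible_def less_irrefl)
  then have "det C * det B = 1"
    by (metis det_I det_mul)
  then have "det C > 0"
    using B by (metis zero_less_mult_pos2 zero_less_one)
  have "{real_comb A (real_comb B ?V) | A. det A > 0} = {real_comb A ?V | A. det A > 0}"
  proof (intro set_eqI iffI; clarify)
    fix A :: "real^3^3" assume "det A > 0"
    then show "\<exists>A'. real_comb A (real_comb B ?V) = real_comb A' ?V \<and> det A' > 0"
      using B by (intro exI[of _ "A ** B"]) (simp add: real_comb_mult det_mul)
  next
    fix A :: "real^3^3" assume "det A > 0"
    moreover have "real_comb A ?V = real_comb (A ** C) (real_comb B ?V)"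
      using C by (simp flip: real_comb_mult matrix_mul_assoc)
    ultimately show "\<exists>A'. real_comb A ?V = real_comb A' (real_comb B ?V) \<and> det A' > 0"
      using \<open>det C > 0\<close> by (intro exI[of _ "A ** C"]) (simp add: det_mul)
  qed
  then show ?thesis
    by (simp add: oplane_real_comb assms(2))
qed

text \<open>
  All changes of basis that occur fix the radial vector \<open>u\<close>: rescalings of the other two vectors,
  rotations between them, and changes of coordinate on the surface.
\<close>

lemma oplane_block:
  assumes "a * d - b * c > 0"
  shows "oplane u (a *\<^sub>R v + b *\<^sub>R w) (c *\<^sub>R v + d *\<^sub>R w) = oplane u v w"
  using assms
  by (intro oplane_basis_change[of "vector [vector [1, 0, 0], vector [0, a, b], vector [0, c, d]]"])
    (simp_all add: det_3 real_comb_def vec_eq_iff[of "vector _"] forall_3 sum_3)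

lemma oplane_SL_real_comb:
  assumes "oplane u v w \<in> SL"
  obtains g and A :: "real^3^3" where "g \<in> SU3" "det A > 0"
    "u = A$1$1 *\<^sub>R column 1 g + A$1$2 *\<^sub>R column 2 g + A$1$3 *\<^sub>R column 3 g"
    "v = A$2$1 *\<^sub>R column 1 g + A$2$2 *\<^sub>R column 2 g + A$2$3 *\<^sub>R column 3 g"
    "w = A$3$1 *\<^sub>R column 1 g + A$3$2 *\<^sub>R column 2 g + A$3$3 *\<^sub>R column 3 g"
proof -
  obtain g where g: "g \<in> SU3" "oplane u v w = oplane (column 1 g) (column 2 g) (column 3 g)"
    using assms by (auto simp: SL_iff)
  have "vector [u, v, w] \<in> oplane u v w"
    by (rule basis_in_oplane)
  then have "vector [u, v, w] \<in> oplane (column 1 g) (column 2 g) (column 3 g)"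
    by (simp add: g)
  then show thesis
    using that[OF g(1)] unfolding oplane_def by (auto simp: forall_3)
qed

lemma oplane_SL_nonzero:
  assumes "oplane u v w \<in> SL"
  shows "v \<noteq> 0"
proof
  assume "v = 0"
  obtain g and A :: "real^3^3" where g: "g \<in> SU3" and A: "det A > 0"
    and v: "v = A$2$1 *\<^sub>R column 1 g + A$2$2 *\<^sub>R column 2 g + A$2$3 *\<^sub>R column 3 g"
    using oplane_SL_real_comb[OF assms] by metis
  have "hdot (column j g) v = of_real (A$2$j)" for j
    using exhaust_3[of j]
        by (auto simp: v hdot.add_right hdot.scaleR_right SU3_columns[OF g] scaleR_conv_of_real[where 'a = complex])
  then have "A$2$j = 0" for j
    using \<open>v = 0\<close> by (simp add: hdot.zero_right)
  then show False
    using A by (simp add: det_3)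
qed

text \<open>
  An oriented orthonormal basis of a special Lagrangian plane \<open>g (e\<^sub>1 \<and> e\<^sub>2 \<and> e\<^sub>3)\<close> is obtained from the
  columns of \<open>g\<close> by a real matrix of positive determinant.  Such a combination of unitary vectors has
  real Hermitian products, so Euclidean orthonormality implies the Hermitian one, and the determinant,
  positive and of modulus one, equals one.
\<close>

lemma orthonormal_frame_in_SU3:
  assumes SL: "oplane u v w \<in> SL"
    and on: "norm u = 1" "norm v = 1" "norm w = 1" "u \<bullet> v = 0" "u \<bullet> w = 0"
        "v \<bullet> w = 0"
  shows "frame u v w \<in> SU3"
proof -
  obtain g and A :: "real^3^3" where g: "g \<in> SU3" and A: "det A > 0"
    and u: "u = A$1$1 *\<^sub>R column 1 g + A$1$2 *\<^sub>R column 2 g + A$1$3 *\<^sub>R column 3 g"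
    and v: "v = A$2$1 *\<^sub>R column 1 g + A$2$2 *\<^sub>R column 2 g + A$2$3 *\<^sub>R column 3 g"
    and w: "w = A$3$1 *\<^sub>R column 1 g + A$3$2 *\<^sub>R column 2 g + A$3$3 *\<^sub>R column 3 g"
    using oplane_SL_real_comb[OF SL] by metis
  have real: "Im (hdot u v) = 0" "Im (hdot u w) = 0" "Im (hdot v w) = 0"
    by (simp_all add: u v w hdot.add_right hdot.scaleR_right hdot.add_left hdot.scaleR_left
        SU3_columns[OF g])
  have "hdot u v = 0" "hdot u w = 0" "hdot v w = 0"
    using real on by (simp_all add: complex_eq_iff Re_hdot)
  then have "hdot u v = 0" "hdot u w = 0" "hdot v w = 0" "hdot v u = 0" "hdot w u = 0" "hdot w v = 0"
    using cnj_hdot[of u v] cnj_hdot[of u w] cnj_hdot[of v w] by auto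
  then have unitary: "herm_transpose (frame u v w) ** frame u v w = mat 1"
    using on by (simp add: unitary_iff forall_3 hdot_self)
  have "frame u v w = g ** (\<chi> i j. of_real (A $ j $ i))"
    by (simp add: frame_def u v w vec_eq_iff forall_3 matrix_matrix_mult_def sum_3 column_def
        scaleR_conv_of_real[where 'a = complex] mult.commute)
  moreover have "det ((\<chi> i j. of_real (A $ j $ i)) :: complex^3^3) = of_real (det A)"
    by (simp add: det_3 algebra_simps)
  ultimately have det: "det (frame u v w) = of_real (det A)"
    using g by (simp add: det_mul SU3_def)
  have "cnj (det (frame u v w)) * det (frame u v w) = 1"
    using arg_cong[OF unitary, of det] by (simp add: det_mul det_herm_transpose)
  then have "(det A)\<^sup>2 = 1"
    unfolding det by (simp add: power2_eq_square flip: of_real_mult)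
  then have "det A = 1"
    using A by (simp add: power2_eq_1_iff)
  then show ?thesis
    using unitary det by (simp add: SU3_def)
qed

lemma norm_column_SU3: "g \<in> SU3 \<Longrightarrow> norm (column i g) = 1"
  using SU3_columns[of g i i] hdot_self[of "column i g"] norm_ge_zero[of "column i g"]
  by (metis of_real_eq_1_iff power2_eq_1_iff le_minus_one_simps(3))

lemma flag_in_FL1:
  assumes "g \<in> SU3"
  shows "flag g \<in> FL1"
proof -
  let ?F = "vector [column 1 g, column 2 g, column 3 g] :: complex^3^3"
  have "?F \<in> oplane (column 1 g) (column 2 g) (column 3 g)"
    by (rule basis_in_oplane)
  moreover have "column 1 g \<in> span (rows ?F)"
    by (intro span_base) (auto simp: rows_def row_def vec_eq_iff intro!: exI[of _ 1])
  ultimately show ?thesis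
    using assms norm_column_SU3[of g 1]
        by (auto simp: FL1_def flag_eq S5_def SL_iff underlying_plane_def)
qed

section \<open>Curves in the special unitary group\<close>

lemma has_derivative_entry:
  fixes M :: "'a::real_normed_vector \<Rightarrow> complex^3^3"
  assumes "(M has_derivative M') F"
  shows "((\<lambda>x. M x $ i $ j) has_derivative (\<lambda>v. M' v $ i $ j)) F"
  by (intro bounded_linear.has_derivative[OF bounded_linear_vec_nth] assms)

lemma has_derivative_matrixI:
  fixes M :: "'a::real_normed_vector \<Rightarrow> complex^3^3"
  assumes "\<And>i j. ((\<lambda>x. M x $ i $ j) has_derivative (\<lambda>v. M' v $ i $ j)) (at x)"
  shows "(M has_derivative M') (at x)"
proof -
  have "((\<lambda>x. M x \<bullet> b) has_derivative (\<lambda>v. M' v \<bullet> b)) (at x)"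
      if b: "b \<in> Basis" for b
  proof -
    obtain i j c where "b = axis i (axis j c)"
      using b by (auto simp: Basis_vec_def)
    then show ?thesis
      using has_derivative_inner_left[OF assms[of i j], of c] by (simp add: inner_axis)
  qed
  then show ?thesis
    using has_derivative_componentwise_within by blast
qed

text \<open>Jacobi's formula in the form suited to a group valued map \<open>M\<close> with \<open>dM = Y M\<close>.\<close>

lemma has_derivative_det:
  fixes M :: "'a::real_normed_vector \<Rightarrow> complex^3^3"
  assumes "(M has_derivative (\<lambda>v. Y v ** M x)) (at x)"
  shows "((\<lambda>x. det (M x)) has_derivative (\<lambda>v. trace (Y v) * det (M x))) (at x)"
proof -
  note e = has_derivative_entry[OF assms]
  show ?thesis
    unfolding det_3
    by (rule has_derivative_eq_rhs,
        (rule has_derivative_add has_derivative_diff has_derivative_mult e)+)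
      (simp add: fun_eq_iff trace_def sum_3 matrix_matrix_mult_def algebra_simps)
qed

lemma bounded_linear_column: "bounded_linear (\<lambda>M :: complex^3^3. column i M)"
  unfolding linear_conv_bounded_linear[symmetric]
  by (auto intro!: linearI simp: column_def vec_eq_iff)

lemma has_derivative_gram:
  fixes M :: "'a::real_normed_vector \<Rightarrow> complex^3^3"
  assumes "(M has_derivative M') (at x)"
  shows "((\<lambda>x. hdot (column i (M x)) (column j (M x))) has_derivative
    (\<lambda>v. hdot (column i (M x)) (column j (M' v)) + hdot (column i (M' v)) (column j (M x)))) (at x)"
  by (intro hdot.FDERIV bounded_linear.has_derivative[OF bounded_linear_column] assms)

lemma su3_iff:
  "X \<in> su3 \<longleftrightarrow> (\<forall>i j. cnj (X $ j $ i) = - X $ i $ j) \<and> X $ 1 $ 1 + X $ 2 $ 2 + X $ 3 $ 3 = 0"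
  by (simp add: su3_def herm_transpose_def vec_eq_iff trace_def sum_3)

text \<open>The Maurer--Cartan form of a map into \<open>SU3\<close> takes values in the Lie algebra.\<close>

lemma Maurer_Cartan_in_su3:
  fixes E :: "'a::real_normed_vector \<Rightarrow> complex^3^3"
  assumes E: "(E has_derivative E') (at z)"
      and U: "open U" "z \<in> U" "\<And>x. x \<in> U \<Longrightarrow> E x \<in> SU3"
  shows "herm_transpose (E z) ** E' v \<in> su3"
proof -
  have zero: "D = (\<lambda>v. 0)"
    if "(f has_derivative D) (at z)"
        "\<And>x. x \<in> U \<Longrightarrow> f x = c" for f :: "'a \<Rightarrow> complex" and D c
  proof -
    have "((\<lambda>x. c) has_derivative D) (at z)"
      using has_derivative_transform_within_open[OF that(1) U(1,2)] that(2) by simp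
    then show ?thesis
      using has_derivative_const has_derivative_unique by blast
  qed
  let ?\<alpha> = "herm_transpose (E z) ** E' v"
  have "hdot (column i (E z)) (column j (E' v)) + hdot (column i (E' v)) (column j (E z)) = 0" for i j
    using zero[OF has_derivative_gram[OF E, of i j]] SU3_columns[OF U(3)] by metis
  then have skew: "cnj (?\<alpha> $ j $ i) = - ?\<alpha> $ i $ j" for i j
    by (simp add: herm_mult_nth cnj_hdot eq_neg_iff_add_eq_0 add.commute)
  have "E' v = (E' v ** herm_transpose (E z)) ** E z" for v
    using U(3)[OF U(2)] by (simp add: SU3_def flip: matrix_mul_assoc)
  then have "(E has_derivative (\<lambda>v. (E' v ** herm_transpose (E z)) ** E z)) (at z)"
    using E by simp
  then have "trace (E' v ** herm_transpose (E z)) * det (E z) = 0"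
    using zero[OF has_derivative_det, of E "\<lambda>v. E' v ** herm_transpose (E z)" 1] U(3)
    by (metis (mono_tags, lifting) SU3_def mem_Collect_eq)
  then have "trace ?\<alpha> = 0"
    using U(2,3) by (simp add: trace_mul_sym[of "herm_transpose (E z)"] SU3_def)
  then show ?thesis
    using skew by (simp add: su3_iff trace_def sum_3)
qed

lemma bounded_linear_matrix_mult: "bounded_linear (\<lambda>Y :: complex^3^3. (X :: complex^3^3) ** Y)"
  unfolding linear_conv_bounded_linear[symmetric]
  by (auto intro!: linearI simp: matrix_matrix_mult_def vec_eq_iff sum_3 scaleR_add_right ring_distribs)

lemma norm_matrix_entry_le: "norm ((M :: complex^3^3) $ i $ j) \<le> norm M"
  by (meson Finite_Cartesian_Product.norm_nth_le order_trans)

text \<open>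
  Entrywise the exponential is an everywhere convergent power series in \<open>t\<close>, so it can be
  differentiated termwise.
\<close>

lemma mat_exp_has_derivative:
  "((\<lambda>t. mat_exp (t *\<^sub>R X)) has_derivative (\<lambda>s. (s *\<^sub>R X) ** mat_exp (t *\<^sub>R X))) (at t)"
proof -
  define P where "P n = ((\<lambda>Y. X ** Y) ^^ n) (mat 1)" for n
  have P_Suc: "P (Suc n) = X ** P n" for n
    by (simp add: P_def)
  have lin: "bounded_linear (\<lambda>Y :: complex^3^3. X ** Y)"
    by (rule bounded_linear_matrix_mult)
  obtain K where K: "0 < K" "\<And>Y :: complex^3^3. norm (X ** Y) \<le> norm Y * K"
    using bounded_linear.pos_bounded[OF lin] by auto
  have P_le: "norm (P n) \<le> K ^ n * norm (mat 1 :: complex^3^3)" for n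
  proof (induction n)
    case (Suc n)
    then show ?case
      unfolding P_Suc using order_trans[OF K(2)[of "P n"] mult_right_mono[OF Suc, of K]] K(1)
      by (simp add: mult_ac)
  qed (simp add: P_def)
  have P_scale: "((\<lambda>Y. (r *\<^sub>R X) ** Y) ^^ n) (mat 1) = r ^ n *\<^sub>R P n" for r n
  proof (induction n)
    case (Suc n)
    then show ?case
      by (simp add: P_Suc matrix_matrix_mult_def vec_eq_iff sum_3 scaleR_conv_of_real[where 'a = complex]
          algebra_simps)
  qed (simp add: P_def)
  have summ: "summable (\<lambda>n. norm (P n) / fact n * a ^ n)" if "a \<ge> 0" for a
  proof (rule summable_comparison_test')
    show "summable (\<lambda>n. norm (mat 1 :: complex^3^3) * (inverse (fact n) * (K * a) ^ n))"
      by (intro summable_mult summable_exp)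
    show "norm (norm (P n) / fact n * a ^ n) \<le> norm (mat 1 :: complex^3^3) * (inverse (fact n) * (K * a) ^ n)" for n
      using mult_right_mono[OF P_le[of n], of "a ^ n / fact n"] that K(1)
      by (simp add: power_mult_distrib field_simps)
  qed
  define c where "c i j n = P n $ i $ j / fact n" for i j n
  have c_summ: "summable (\<lambda>n. c i j n * y ^ n)" for i j y
  proof (rule summable_comparison_test'[OF summ[of "norm y"]])
    show "norm (c i j n * y ^ n) \<le> norm (P n) / fact n * norm y ^ n" for n
      by (auto simp: c_def norm_mult norm_divide norm_power norm_matrix_entry_le
          intro!: mult_right_mono divide_right_mono)
  qed simp
  have entry: "mat_exp (r *\<^sub>R X) $ i $ j = (\<Sum>n. c i j n * of_real r ^ n)" for r i j
  proof -
    have "summable (\<lambda>n. (1 / fact n) *\<^sub>R (r ^ n *\<^sub>R P n))"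
    proof (rule summable_comparison_test'[OF summ[of "\<bar>r\<bar>"]])
      show "norm ((1 / fact n) *\<^sub>R (r ^ n *\<^sub>R P n)) \<le> norm (P n) / fact n * \<bar>r\<bar> ^ n" for n
        by (simp add: power_abs mult.commute)
    qed simp
    then have "mat_exp (r *\<^sub>R X) $ i $ j = (\<Sum>n. ((1 / fact n) *\<^sub>R (r ^ n *\<^sub>R P n)) $ i $ j)"
      unfolding mat_exp_def P_scale
      by (simp only: bounded_linear.suminf[OF bounded_linear_vec_nth]
          bounded_linear.summable[OF bounded_linear_vec_nth])
    then show ?thesis
      by (simp add: c_def scaleR_conv_of_real[where 'a = complex] field_simps)
  qed
  have diffs_c: "diffs (c i j) n = (\<Sum>k\<in>UNIV. X $ i $ k * c k j n)" for i j n
    by (simp add: diffs_def c_def P_Suc matrix_matrix_mult_def sum_3 fact_reduce field_simps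
        del: of_nat_Suc)
  have "((\<lambda>r. mat_exp (r *\<^sub>R X) $ i $ j) has_derivative
      (\<lambda>s. ((s *\<^sub>R X) ** mat_exp (t *\<^sub>R X)) $ i $ j)) (at t)" for i j
  proof -
    have "((\<lambda>z. \<Sum>n. c i j n * z ^ n) has_field_derivative (\<Sum>n. diffs (c i j) n * of_real t ^ n)) (at (of_real t))"
      by (rule termdiffs_strong_converges_everywhere[OF c_summ])
    then have "((\<lambda>r. \<Sum>n. c i j n * of_real r ^ n) has_vector_derivative (\<Sum>n. diffs (c i j) n * of_real t ^ n)) (at t)"
      by (rule has_vector_derivative_real_field)
    moreover have "(\<Sum>n. diffs (c i j) n * of_real t ^ n) = (X ** mat_exp (t *\<^sub>R X)) $ i $ j"
      using c_summ
      by (simp add: diffs_c matrix_matrix_mult_def entry sum_distrib_right mult.assoc suminf_sum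
          summable_mult suminf_mult)
    ultimately show ?thesis
      unfolding has_vector_derivative_def entry[symmetric]
      by (simp add: matrix_matrix_mult_def sum_3 algebra_simps)
  qed
  then show ?thesis
    by (rule has_derivative_matrixI)
qed

lemma mat_exp_0: "mat_exp 0 = mat 1"
proof -
  have "((**) 0 ^^ n) (mat 1 :: complex^3^3) = (if n = 0 then mat 1 else 0)" for n
    by (cases n) auto
  then have "mat_exp 0 = (\<Sum>n. if n = 0 then mat 1 else 0)"
    unfolding mat_exp_def by (intro arg_cong[of _ _ suminf]) (simp add: fun_eq_iff)
  then show ?thesis
    using sums_single[of 0 "\<lambda>_. mat 1 :: complex^3^3"] by (simp add: sums_iff)
qed

text \<open>
  Along \<open>t \<mapsto> mat_exp (t X)\<close> the Gram matrix of the columns and the determinant have zero derivative, since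
  \<open>X\<close> is skew-Hermitian and traceless.
\<close>

lemma mat_exp_in_SU3:
  assumes "X \<in> su3"
  shows "mat_exp (t *\<^sub>R X) \<in> SU3"
proof -
  define M where "M t = mat_exp (t *\<^sub>R X)" for t
  have M: "(M has_derivative (\<lambda>s. (s *\<^sub>R X) ** M t)) (at t)" for t
    unfolding M_def by (rule mat_exp_has_derivative)
  have M0: "M 0 = mat 1"
    by (simp add: M_def mat_exp_0)
  have trX: "trace X = 0" and skewX: "\<And>i j. cnj (X $ j $ i) = - X $ i $ j"
    using assms by (auto simp: su3_iff trace_def sum_3)
  have const: "f t = f 0"
      if "\<And>t. (f has_derivative (\<lambda>s. 0)) (at t)" for f :: "real \<Rightarrow> complex"
    using has_derivative_zero_constant[of UNIV f] that by (metis UNIV_I convex_UNIV)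
  have "((\<lambda>t. det (M t)) has_derivative (\<lambda>s. 0)) (at t)" for t
    using has_derivative_det[OF M] trX by (simp add: trace_def sum_3 flip: scaleR_add_right)
  then have "det (M t) = 1"
    using const[of "\<lambda>t. det (M t)"] M0 by simp
  moreover have skew: "hdot u (X *v w) = - hdot (X *v u) w" for u w
  proof -
    have "hdot u (X *v w) = (\<Sum>i\<in>UNIV. \<Sum>j\<in>UNIV. cnj (u $ i) * X $ i $ j * w $ j)"
      by (simp add: hdot_def matrix_vector_mult_def sum_distrib_left mult.assoc)
    also have "\<dots> = (\<Sum>i\<in>UNIV. \<Sum>j\<in>UNIV. - (cnj (X $ j $ i) * cnj (u $ i) * w $ j))"
      by (simp add: skewX mult_ac)
    also have "\<dots> = - hdot (X *v u) w"
      by (simp add: hdot_def matrix_vector_mult_def sum_3 algebra_simps)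
    finally show ?thesis .
  qed
  have col: "column j ((s *\<^sub>R X) ** M t) = s *\<^sub>R (X *v column j (M t))" for s t j
    by (simp add: column_def matrix_matrix_mult_def matrix_vector_mult_def vec_eq_iff sum_3 scaleR_add_right)
  have "((\<lambda>t. hdot (column i (M t)) (column j (M t))) has_derivative (\<lambda>s. 0)) (at t)" for i j t
    using has_derivative_gram[OF M, of i j]
    by (simp add: col hdot.scaleR_left hdot.scaleR_right skew)
  then have "hdot (column i (M t)) (column j (M t)) = hdot (column i (M 0)) (column j (M 0))" for i j
    by (rule const)
  then have "herm_transpose (M t) ** M t = mat 1"
    unfolding unitary_iff using SU3_columns[of "mat 1"] M0
    by (simp add: hdot_def column_def mat_def sum_3 forall_3)
  ultimately show ?thesis
    by (simp add: SU3_def M_def)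
qed

lemma SU3_mult: "g \<in> SU3 \<Longrightarrow> k \<in> SU3 \<Longrightarrow> g ** k \<in> SU3"
proof -
  assume g: "g \<in> SU3" and k: "k \<in> SU3"
  have "herm_transpose (g ** k) = herm_transpose k ** herm_transpose g"
    by (simp add: herm_transpose_def matrix_matrix_mult_def vec_eq_iff mult.commute)
  then have "herm_transpose (g ** k) ** (g ** k) = herm_transpose k ** (herm_transpose g ** g) ** k"
    by (simp add: matrix_mul_assoc)
  then show "g ** k \<in> SU3"
    using g k by (simp add: SU3_def det_mul)
qed

section \<open>The eigenspace of the order six automorphism\<close>

text \<open>
  The off-diagonal entry of \<open>Rot\<close>; kept as a constant with \<open>sin60 * sin60 = 3/4\<close>, it makes the
  eigenvalue equation a system of polynomial identities.
\<close>

definition sin60 :: complex where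
  "sin60 = of_real (sqrt 3 / 2)"

lemma sin60_square: "sin60 * sin60 = 3/4"
proof -
  have "sin60 * sin60 = of_real (sqrt 3 / 2 * (sqrt 3 / 2))"
    unfolding sin60_def of_real_mult ..
  also have "sqrt 3 / 2 * (sqrt 3 / 2) = 3 / 4"
    by simp
  finally show ?thesis
    by simp
qed

lemma Rot_nth:
  "Rot $ 1 $ 1 = 1" "Rot $ 1 $ 2 = 0" "Rot $ 1 $ 3 = 0"
  "Rot $ 2 $ 1 = 0" "Rot $ 2 $ 2 = 1/2" "Rot $ 2 $ 3 = sin60"
  "Rot $ 3 $ 1 = 0" "Rot $ 3 $ 2 = - sin60" "Rot $ 3 $ 3 = 1/2"
  by (simp_all only: Rot_def vector_3 cos_of_real sin_of_real cos_60 sin_60 sin60_def) simp_all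

lemma matrix_inv_Rot: "matrix_inv Rot = transpose Rot"
proof -
  have "Rot ** transpose Rot = mat 1"
    by (simp add: vec_eq_iff forall_3 matrix_matrix_mult_def sum_3 transpose_def mat_def Rot_nth sin60_square)
  then have inv: "Rot ** transpose Rot = mat 1 \<and> transpose Rot ** Rot = mat 1"
    using matrix_left_right_inverse by blast
  then have "Rot ** matrix_inv Rot = mat 1 \<and> matrix_inv Rot ** Rot = mat 1"
    unfolding matrix_inv_def by (rule someI)
  then show ?thesis
    using inv by (metis matrix_mul_assoc matrix_mul_lid matrix_mul_rid)
qed

lemma eps_eq: "eps = - 1/2 + \<i> * sin60"
proof -
  have angle: "2 * pi / 3 = pi - pi / 3"
    by simp
  have "cos (2 * pi / 3) = - 1/2" "sin (2 * pi / 3) = sqrt 3 / 2"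
    unfolding angle by (simp_all only: cos_pi_minus sin_pi_minus cos_60 sin_60)
  moreover have "eps = cis (2 * pi / 3)"
    unfolding eps_def cis_conv_exp by (simp add: field_simps)
  ultimately show ?thesis
    by (simp add: complex_eq_iff sin60_def)
qed

lemma Rot_conjugate_nth:
  fixes X :: "complex^3^3"
  defines "Y \<equiv> Rot ** transpose X ** transpose Rot"
  shows "Y$1$1 = X$1$1"
    "Y$1$2 = X$2$1 / 2 + sin60 * X$3$1" "Y$1$3 = X$3$1 / 2 - sin60 * X$2$1"
    "Y$2$1 = X$1$2 / 2 + sin60 * X$1$3" "Y$3$1 = X$1$3 / 2 - sin60 * X$1$2"
    "Y$2$2 = X$2$2 / 4 + sin60 * (X$2$3 + X$3$2) / 2 + 3/4 * X$3$3"
    "Y$2$3 = X$3$2 / 4 + sin60 * (X$3$3 - X$2$2) / 2 - 3/4 * X$2$3"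
    "Y$3$2 = X$2$3 / 4 + sin60 * (X$3$3 - X$2$2) / 2 - 3/4 * X$3$2"
    "Y$3$3 = X$3$3 / 4 - sin60 * (X$3$2 + X$2$3) / 2 + 3/4 * X$2$2"
proof -
  have Y: "Y $ i $ j = (\<Sum>l\<in>UNIV. (\<Sum>k\<in>UNIV. Rot $ i $ k * X $ l $ k) * Rot $ j $ l)" for i j
    by (simp add: Y_def matrix_matrix_mult_def transpose_def)
  have s: "3/4 = sin60 * sin60"
    using sin60_square by simp
  show "Y$1$1 = X$1$1"
    "Y$1$2 = X$2$1 / 2 + sin60 * X$3$1" "Y$1$3 = X$3$1 / 2 - sin60 * X$2$1"
    "Y$2$1 = X$1$2 / 2 + sin60 * X$1$3" "Y$3$1 = X$1$3 / 2 - sin60 * X$1$2"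
    by (simp_all add: Y sum_3 Rot_nth)
  show "Y$2$2 = X$2$2 / 4 + sin60 * (X$2$3 + X$3$2) / 2 + 3/4 * X$3$3"
    "Y$2$3 = X$3$2 / 4 + sin60 * (X$3$3 - X$2$2) / 2 - 3/4 * X$2$3"
    "Y$3$2 = X$2$3 / 4 + sin60 * (X$3$3 - X$2$2) / 2 - 3/4 * X$3$2"
    "Y$3$3 = X$3$3 / 4 - sin60 * (X$3$2 + X$2$3) / 2 + 3/4 * X$2$2"
    unfolding s by (simp_all add: Y sum_3 Rot_nth field_simps)
qed

lemma ghat1_iff:
  "X \<in> ghat1 \<longleftrightarrow> trace X = 0 \<and> (\<forall>i j. (Rot ** transpose X ** transpose Rot) $ i $ j = eps * X $ i $ j)"
proof -
  have "(mat (- eps) ** X) $ i $ j = - (eps * X $ i $ j)" for i j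
    by (simp add: matrix_matrix_mult_def mat_def if_distrib[of "\<lambda>x. x * _"] cong: if_cong)
  then show ?thesis
    by (simp add: ghat1_def matrix_inv_Rot vec_eq_iff)
qed

text \<open>
  The first row is a multiple of the eigenvector \<open>(1, -i)\<close> of the rotation by \<open>\<pi>/3\<close>, and the lower block
  is \<open>b v v\<^sup>t\<close> for the eigenvector \<open>v = (1, i)\<close>.
\<close>

lemma ghat1I:
  assumes "X$1$1 = 0" "X$2$1 = - a" "X$3$1 = \<i> * a" "X$1$2 = a" "X$1$3 = - \<i> * a"
    "X$2$2 = b" "X$2$3 = \<i> * b" "X$3$2 = \<i> * b" "X$3$3 = - b"
  shows "X \<in> ghat1"
proof -
  have i: "\<i> * (\<i> * x) = - x" for x
    by (simp flip: mult.assoc)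
  show ?thesis
    unfolding ghat1_iff forall_3 trace_def sum_3 Rot_conjugate_nth assms eps_eq
    by (intro conjI; simp add: field_simps i)
qed

text \<open>
  The first row and column determine the derivative of the projection to the sphere.
\<close>

lemma ghat1D:
  assumes "X \<in> ghat1"
  shows "X$1$1 = 0" "X$2$1 = - X$1$2" "X$3$1 = \<i> * X$1$2" "X$1$3 = - \<i> * X$1$2"
proof -
  have "(Rot ** transpose X ** transpose Rot) $ i $ j = eps * X $ i $ j" for i j
    using assms by (simp add: ghat1_iff)
  note e = this[of 1 1] this[of 1 2] this[of 1 3] this[of 2 1] this[of 3 1]
  note e = e[unfolded Rot_conjugate_nth eps_eq]
  have i: "\<i> * \<i> = -1"
    by simp
  have ne: "3/4 + \<i> * sin60 / 2 \<noteq> 0" "(- 1/2 + \<i> * sin60) - 1 \<noteq> 0"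
    by (auto simp: complex_eq_iff sin60_def)
  have "((- 1/2 + \<i> * sin60) - 1) * X$1$1 = 0"
    using e(1) by algebra
  then show "X$1$1 = 0"
    using ne(2) by simp
  (* substitute the equations for the first column into those for the first row *)
  have "(3/4 + \<i> * sin60 / 2) * (X$2$1 - \<i> * X$3$1) = 0"
    using e(2-5) i sin60_square by algebra
  then have uv: "X$2$1 = \<i> * X$3$1"
    using ne(1) by simp
  show u: "X$2$1 = - X$1$2"
    using e(2-5) i sin60_square uv by algebra
  show "X$3$1 = \<i> * X$1$2"
    using u uv i by algebra
  show "X$1$3 = - \<i> * X$1$2"
    using e(2-5) i sin60_square uv u by algebra
qed

text \<open>
  Here \<open>A + iB\<close> is the decomposition with respect to the compact real form.  The relations between the
  first row and the first column force the first columns of \<open>A\<close> and \<open>B\<close> to be real, and make the second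
  one the first one turned by a right angle.  This is the source of conformality and of the Legendrian
  condition.
\<close>

lemma su3_ghat1_first_column:
  assumes A: "A \<in> su3" and B: "B \<in> su3" and X: "A + mat \<i> ** B \<in> ghat1"
  obtains p q :: real where
    "A$1$1 = 0" "A$2$1 = of_real p" "A$3$1 = of_real q"
    "B$1$1 = 0" "B$2$1 = of_real q" "B$3$1 = - of_real p"
proof -
  have nth: "(A + mat \<i> ** B) $ i $ j = A $ i $ j + \<i> * B $ i $ j" for i j
    by (simp add: matrix_matrix_mult_def mat_def if_distrib[of "\<lambda>x. x * _"] cong: if_cong)
  have sA: "A$1$1 = - cnj (A$1$1)" "A$1$2 = - cnj (A$2$1)" "A$1$3 = - cnj (A$3$1)"
    and sB: "B$1$1 = - cnj (B$1$1)" "B$1$2 = - cnj (B$2$1)" "B$1$3 = - cnj (B$3$1)"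
    using A B unfolding su3_iff by (metis minus_minus)+
  note X' = ghat1D[OF X, unfolded nth]
  note eqs = sA[unfolded complex_eq_iff, simplified] sB[unfolded complex_eq_iff, simplified]
    X'[unfolded complex_eq_iff, simplified]
  have "Re (A$1$1) = 0" "Im (A$1$1) = 0" "Im (A$2$1) = 0" "Im (A$3$1) = 0"
    "Re (B$1$1) = 0" "Im (B$1$1) = 0" "Im (B$2$1) = 0" "Im (B$3$1) = 0"
    "Re (B$2$1) = Re (A$3$1)" "Re (B$3$1) = - Re (A$2$1)"
    using eqs by linarith+
  then have "A$1$1 = 0" "A$2$1 = of_real (Re (A$2$1))" "A$3$1 = of_real (Re (A$3$1))"
    "B$1$1 = 0" "B$2$1 = of_real (Re (A$3$1))" "B$3$1 = - of_real (Re (A$2$1))"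
    by (simp_all add: complex_eq_iff)
  then show thesis
    by (rule that)
qed


section \<open>Tangent vectors of the flag manifold\<close>

text \<open>
  The generator of the Lie algebra of \<open>K\<^sub>1\<close>: it annihilates \<open>e\<^sub>1\<close> and rotates \<open>e\<^sub>2\<close> towards \<open>e\<^sub>3\<close>.
\<close>

definition vert :: "complex^3^3" where
  "vert = frame 0 (axis 3 1) (- axis 2 1)"

lemma vert_nth:
  "vert$1$1 = 0" "vert$1$2 = 0" "vert$1$3 = 0" "vert$2$1 = 0" "vert$2$2 = 0" "vert$2$3 = -1"
  "vert$3$1 = 0" "vert$3$2 = 1" "vert$3$3 = 0"
  by (simp_all add: vert_def frame_def axis_def)

text \<open>
  As the exponential curve stays in \<open>SU3\<close>, the smooth extension \<open>H\<close> may be differentiated instead of the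
  function on the quotient.
\<close>

lemma curve_deriv_eq:
  assumes H: "open W" "SU3 \<subseteq> W" "smooth_on W H"
      "\<And>g. g \<in> SU3 \<Longrightarrow> h (flag g) = H g"
    and g: "g \<in> SU3" and X: "X \<in> su3"
  shows "curve_deriv g X h = frechet_derivative H (at g) (g ** X)"
proof -
  let ?D = "frechet_derivative H (at g)"
  have D: "(H has_derivative ?D) (at g)"
    using smooth_on_has_derivative[OF H(3)] H(2) g by blast
  have lin: "bounded_linear (\<lambda>Y :: complex^3^3. g ** Y)"
    by (rule bounded_linear_matrix_mult)
  have "((\<lambda>t. mat_exp (t *\<^sub>R X)) has_derivative (\<lambda>s. s *\<^sub>R X)) (at 0)"
    using mat_exp_has_derivative[of X 0] by (simp add: mat_exp_0)
  then have "((\<lambda>t. g ** mat_exp (t *\<^sub>R X)) has_derivative (\<lambda>s. g ** (s *\<^sub>R X))) (at 0)"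
    by (rule bounded_linear.has_derivative[OF lin])
  then have "((\<lambda>t. H (g ** mat_exp (t *\<^sub>R X))) has_derivative (\<lambda>s. ?D (g ** (s *\<^sub>R X)))) (at 0)"
    by (rule has_derivative_compose) (simp add: mat_exp_0 D)
  moreover have "?D (g ** (s *\<^sub>R X)) = ?D (g ** X) * s" for s
    using linear_scale[OF bounded_linear.linear[OF lin], of s X] linear_scale[OF has_derivative_linear[OF D]]
    by simp
  ultimately have "((\<lambda>t. H (g ** mat_exp (t *\<^sub>R X))) has_real_derivative ?D (g ** X)) (at 0)"
    by (simp add: has_field_derivative_def)
  moreover have "h (flag (g ** mat_exp (t *\<^sub>R X))) = H (g ** mat_exp (t *\<^sub>R X))" for t
    by (intro H(4) SU3_mult g mat_exp_in_SU3 X)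
  ultimately show ?thesis
    by (simp add: curve_deriv_def DERIV_imp_deriv)
qed

text \<open>
  Functions on the quotient are constant along the orbits of \<open>K\<^sub>1\<close>, the curves
  \<open>g exp (t vert)\<close>; the exponential is an explicit rotation here.
\<close>

lemma vertical_derivative_zero:
  assumes H: "open W" "SU3 \<subseteq> W" "smooth_on W H"
      "\<And>g. g \<in> SU3 \<Longrightarrow> h (flag g) = H g"
    and g: "g \<in> SU3"
  shows "frechet_derivative H (at g) (g ** vert) = 0"
proof -
  let ?D = "frechet_derivative H (at g)"
  define k :: "real \<Rightarrow> complex^3^3" where
    "k t = frame (axis 1 1) (cos t *\<^sub>R axis 2 1 + sin t *\<^sub>R axis 3 1)
      ((- sin t) *\<^sub>R axis 2 1 + cos t *\<^sub>R axis 3 1)" for t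
  have D: "(H has_derivative ?D) (at g)"
    using smooth_on_has_derivative[OF H(3)] H(2) g by blast
  have sc: "complex_of_real (cos t) * of_real (cos t) + of_real (sin t) * of_real (sin t) = 1" for t
    unfolding of_real_mult[symmetric] of_real_add[symmetric] by (simp flip: power2_eq_square)
  have k: "k t \<in> SU3" for t
  proof -
    have "herm_transpose (k t) ** k t = mat 1"
      using sc[of t] by (simp add: unitary_iff forall_3 k_def hdot_def sum_3 axis_def
          scaleR_conv_of_real[where 'a = complex] algebra_simps)
    moreover have "det (k t) = 1"
      using sc[of t] by (simp add: det_3 frame_def k_def axis_def
          scaleR_conv_of_real[where 'a = complex] algebra_simps)
    ultimately show ?thesis
      by (simp add: SU3_def)
  qed
  have col: "column 1 (g ** k t) = column 1 g"
    "column 2 (g ** k t) = cos t *\<^sub>R column 2 g + sin t *\<^sub>R column 3 g"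
    "column 3 (g ** k t) = (- sin t) *\<^sub>R column 2 g + cos t *\<^sub>R column 3 g" for t
    by (simp_all add: column_def k_def frame_def matrix_matrix_mult_def sum_3 vec_eq_iff axis_def
        scaleR_conv_of_real[where 'a = complex] mult.commute)
  have "flag (g ** k t) = flag g" for t
    unfolding flag_eq col
    by (subst oplane_block) (simp_all flip: power2_eq_square)
  then have const: "H (g ** k t) = h (flag g)" for t
    using H(4)[OF SU3_mult[OF g k]] by simp
  have "(k has_derivative (\<lambda>s. s *\<^sub>R vert)) (at 0)"
  proof (rule has_derivative_matrixI)
    fix i j :: 3
    show "((\<lambda>t. k t $ i $ j) has_derivative (\<lambda>s. (s *\<^sub>R vert) $ i $ j)) (at 0)"
      using exhaust_3[of i] exhaust_3[of j]
      by (elim disjE) (auto simp: k_def vert_def frame_def axis_def intro!: derivative_eq_intros)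
  qed
  moreover have lin: "bounded_linear (\<lambda>Y :: complex^3^3. g ** Y)"
    by (rule bounded_linear_matrix_mult)
  ultimately have gk: "((\<lambda>t. g ** k t) has_derivative (\<lambda>s. g ** (s *\<^sub>R vert))) (at 0)"
    using bounded_linear.has_derivative by blast
  have "g ** k 0 = g"
    using col[of 0] frame_columns[of "g ** k 0"] frame_columns[of g] by simp
  then have "((\<lambda>t. H (g ** k t)) has_derivative (\<lambda>s. ?D (g ** (s *\<^sub>R vert)))) (at 0)"
    using D by (intro has_derivative_compose[OF gk]) simp
  then have "(\<lambda>s. ?D (g ** (s *\<^sub>R vert))) = (\<lambda>s. 0)"
    unfolding const using has_derivative_unique has_derivative_const by blast
  from fun_cong[OF this, of 1] show ?thesis
    by simp
qed

lemma subspace_su3: "subspace su3"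
proof (unfold subspace_def, intro conjI ballI allI)
  show "0 \<in> su3"
    by (simp add: su3_iff)
  show "x + y \<in> su3" if "x \<in> su3" "y \<in> su3" for x y
    using that by (auto simp: su3_iff algebra_simps add_eq_0_iff)
  show "c *\<^sub>R x \<in> su3" if "x \<in> su3" for c x
    using that by (auto simp: su3_iff simp flip: scaleR_add_right)
qed

lemma vert_in_su3: "vert \<in> su3"
  by (simp add: su3_iff forall_3 vert_nth)

text \<open>
  Here \<open>a\<close> and \<open>b\<close> are the values of the Maurer--Cartan form of a lift on \<open>\<partial>/\<partial>x\<close> and \<open>\<partial>/\<partial>y\<close>.  The
  equations for the first columns and for the imaginary parts put the \<open>dz\<close> part \<open>(a - ib)/2\<close> into the
  sum of the eigenspace and the complex multiples of \<open>vert\<close>.  Subtracting the latter does not change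
  the tangent vector, because functions on the quotient have zero derivative in the direction \<open>g vert\<close>.
\<close>

lemma Maurer_Cartan_in_ghat1_fibre:
  assumes g: "g \<in> SU3" and su: "a \<in> su3" "b \<in> su3"
    and a1: "a$1$1 = 0" "a$2$1 = of_real l" "a$3$1 = 0"
    and b1: "b$1$1 = 0" "b$2$1 = 0" "b$3$1 = of_real l"
    and im: "Im (b$2$2) = Im (a$2$3)" "Im (b$3$2) = Im (a$3$3)"
    and D: "\<And>h W H. open W \<Longrightarrow> SU3 \<subseteq> W \<Longrightarrow> smooth_on W H \<Longrightarrow> (\<And>k. k \<in> SU3 \<Longrightarrow> h (flag k) = H k) \<Longrightarrow>
      Dx h = frechet_derivative H (at g) (g ** a) \<and> Dy h = frechet_derivative H (at g) (g ** b)"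
  shows "(\<lambda>h\<in>smooth_FL1. (of_real (Dx h) - \<i> * of_real (Dy h)) / 2) \<in> ghat1_fibre (flag g)"
proof -
  define A where "A = (1/2) *\<^sub>R (a - Re (a$3$2) *\<^sub>R vert)"
  define B where "B = (- 1/2) *\<^sub>R (b - Re (b$3$2) *\<^sub>R vert)"
  have A: "A \<in> su3" and B: "B \<in> su3"
    unfolding A_def B_def
    by (intro subspace_scale[OF subspace_su3] subspace_diff[OF subspace_su3] su vert_in_su3)+
  have nth: "(A + mat \<i> ** B) $ i $ j = A $ i $ j + \<i> * B $ i $ j" for i j
    by (simp add: matrix_matrix_mult_def mat_def if_distrib[of "\<lambda>x. x * _"] cong: if_cong)
  have skew: "a$i$j = - cnj (a$j$i)" "b$i$j = - cnj (b$j$i)" for i j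
    using su unfolding su3_iff by (metis minus_minus)+
  have tr: "a$2$2 + a$3$3 = 0" "b$2$2 + b$3$3 = 0"
    using su a1 b1 unfolding su3_iff by simp_all
  note eqs = skew[of 1 2] skew[of 1 3] skew[of 2 2] skew[of 2 3] skew[of 3 3] tr
  have "A + mat \<i> ** B \<in> ghat1"
  proof (rule ghat1I[of _ "- of_real (l / 2)" "A$2$2 + \<i> * B$2$2"])
  qed (use eqs a1 b1 im in \<open>unfold nth, auto simp: A_def B_def vert_nth complex_eq_iff\<close>)
  moreover have "(of_real (Dx h) - \<i> * of_real (Dy h)) / 2 = Complex (curve_deriv g A h) (curve_deriv g B h)"
    if "h \<in> smooth_FL1" for h
  proof -
    obtain W H where H: "open W" "SU3 \<subseteq> W" "smooth_on W H"
        "\<And>k. k \<in> SU3 \<Longrightarrow> h (flag k) = H k"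
      using \<open>h \<in> smooth_FL1\<close> unfolding smooth_FL1_def by auto
    let ?D = "frechet_derivative H (at g)"
    have lin: "linear ?D"
      using smooth_on_has_derivative[OF H(3)] H(2) g by (blast intro: has_derivative_linear)
    have v: "?D (g ** vert) = 0"
      by (rule vertical_derivative_zero[where h = h, OF H g])
    have gA: "g ** A = (1/2) *\<^sub>R (g ** a) - (Re (a$3$2) / 2) *\<^sub>R (g ** vert)"
      and gB: "g ** B = (- 1/2) *\<^sub>R (g ** b) + (Re (b$3$2) / 2) *\<^sub>R (g ** vert)"
      by (simp_all add: A_def B_def matrix_matrix_mult_def vec_eq_iff sum_3 algebra_simps)
    have D': "?D (g ** a) = Dx h" "?D (g ** b) = Dy h"
      using D[where h = h, OF H] by simp_all
    have "curve_deriv g A h = ?D (g ** A)"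
      by (rule curve_deriv_eq[where h = h, OF H g A])
    also have "\<dots> = Dx h / 2"
      unfolding gA by (simp add: linear_diff[OF lin] linear_scale[OF lin] v D' del: scaleR_minus_left)
    finally have dA: "curve_deriv g A h = Dx h / 2" .
    have "curve_deriv g B h = ?D (g ** B)"
      by (rule curve_deriv_eq[where h = h, OF H g B])
    also have "\<dots> = - Dy h / 2"
      unfolding gB by (simp add: linear_add[OF lin] linear_scale[OF lin] v D' del: scaleR_minus_left)
    finally have dB: "curve_deriv g B h = - Dy h / 2" .
    show ?thesis
      by (simp add: dA dB complex_eq_iff)
  qed
  then have "(\<lambda>h\<in>smooth_FL1. (of_real (Dx h) - \<i> * of_real (Dy h)) / 2) = tangent_vector g A B"
    by (auto simp: tangent_vector_def restrict_def)
  ultimately show ?thesis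
    unfolding ghat1_fibre_def using g A B by blast
qed

text \<open>
  As test functions the coordinates of the projection to the sphere suffice to recover \<open>df\<close> from \<open>d\<psi>\<close>,
  and to see that \<open>\<psi>\<close> is an immersion where \<open>f\<close> is one.
\<close>

lemma coordinate_in_smooth_FL1: "(\<lambda>q. fst q \<bullet> b) \<in> smooth_FL1"
  and curve_deriv_coordinate:
    "g \<in> SU3 \<Longrightarrow> X \<in> su3 \<Longrightarrow> curve_deriv g X (\<lambda>q. fst q \<bullet> b) = (g *v column 1 X) \<bullet> b"
proof -
  let ?H = "\<lambda>g :: complex^3^3. column 1 g \<bullet> b"
  have lin: "bounded_linear ?H"
    by (intro bounded_linear_compose[OF bounded_linear_inner_left] bounded_linear_column)
  have H: "open UNIV" "SU3 \<subseteq> UNIV" "smooth_on UNIV ?H"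
      "\<And>g. g \<in> SU3 \<Longrightarrow> fst (flag g) \<bullet> b = ?H g"
    using Ck_on_bounded_linear[OF open_UNIV lin] by (auto simp: smooth_on_def flag_eq)
  then show "(\<lambda>q. fst q \<bullet> b) \<in> smooth_FL1"
    unfolding smooth_FL1_def by blast
  assume g: "g \<in> SU3" and X: "X \<in> su3"
  have "frechet_derivative ?H (at g) = ?H"
    using frechet_derivative_at[OF bounded_linear_imp_has_derivative[OF lin]] by metis
  then show "curve_deriv g X (\<lambda>q. fst q \<bullet> b) = (g *v column 1 X) \<bullet> b"
    using curve_deriv_eq[OF H g X]
    by (simp add: column_def matrix_matrix_mult_def matrix_vector_mult_def)
qed


section \<open>Structure equations of a conformal special Legendrian immersion\<close>

definition part_x :: "(complex \<Rightarrow> 'b::real_normed_vector) \<Rightarrow> complex \<Rightarrow> 'b" where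
  "part_x F z = frechet_derivative F (at z) 1"

definition part_y :: "(complex \<Rightarrow> 'b::real_normed_vector) \<Rightarrow> complex \<Rightarrow> 'b" where
  "part_y F z = frechet_derivative F (at z) \<i>"

text \<open>
  For conformal \<open>F\<close> the lengths of \<open>F\<^sub>x\<close> and \<open>F\<^sub>y\<close> agree, so one factor normalises both.
\<close>

definition adapted_frame :: "(complex \<Rightarrow> complex^3) \<Rightarrow> complex \<Rightarrow> complex^3^3" where
  "adapted_frame F z =
     (let r = inverse (norm (part_x F z)) in frame (F z) (r *\<^sub>R part_x F z) (r *\<^sub>R part_y F z))"

lemma smooth_part: "smooth_on U F \<Longrightarrow> smooth_on U (part_x F)"
    "smooth_on U F \<Longrightarrow> smooth_on U (part_y F)"
  unfolding part_x_def part_y_def by (rule smooth_on_derivative; assumption)+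

lemma adapted_frame_part_x_nonzero: "adapted_frame F z \<in> SU3 \<Longrightarrow> part_x F z \<noteq> 0"
  using norm_column_SU3[of "adapted_frame F z" 2] by (auto simp: adapted_frame_def Let_def)

lemma smooth_adapted_frame:
  assumes F: "smooth_on U F" and U: "open U"
      and nz: "\<And>z. z \<in> U \<Longrightarrow> part_x F z \<noteq> 0"
  shows "smooth_on U (adapted_frame F)"
  unfolding smooth_on_def
proof
  fix k
  have ck: "Ck_on k U F" "Ck_on k U (part_x F)" "Ck_on k U (part_y F)"
    using F smooth_part[OF F] by (auto simp: smooth_on_def)
  have r: "Ck_on k U (\<lambda>z. inverse (norm (part_x F z)))"
    by (intro Ck_on_inverse_norm U nz ck)
  note scale = Ck_on_bilinear[OF U bounded_bilinear_scaleR r]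
  have lin: "bounded_linear (\<lambda>u. frame u 0 0)" "bounded_linear (\<lambda>v. frame 0 v 0)"
      "bounded_linear (\<lambda>w. frame 0 0 w)"
    unfolding linear_conv_bounded_linear[symmetric]
    by (auto intro!: linearI simp: frame_def vec_eq_iff)
  have "frame u v w = frame u 0 0 + (frame 0 v 0 + frame 0 0 w)" for u v w
    by (simp add: frame_def vec_eq_iff)
  then have split: "adapted_frame F = (\<lambda>z. frame (F z) 0 0 +
      (frame 0 (inverse (norm (part_x F z)) *\<^sub>R part_x F z) 0 +
       frame 0 0 (inverse (norm (part_x F z)) *\<^sub>R part_y F z)))"
    unfolding adapted_frame_def Let_def fun_eq_iff by metis
  show "Ck_on k U (adapted_frame F)"
    unfolding split by (intro Ck_on_add[OF U] Ck_on_linear_image[OF U lin(1)]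
        Ck_on_linear_image[OF U lin(2)] Ck_on_linear_image[OF U lin(3)] scale ck)
qed

lemma orthogonal_to_SU3_columns:
  assumes "g \<in> SU3" "\<And>i. hdot (column i g) w = 0"
  shows "w = 0"
proof -
  have "herm_transpose g *v w = 0"
    using assms(2) by (simp add: vec_eq_iff matrix_vector_mult_def herm_transpose_def hdot_def column_def)
  then have "(g ** herm_transpose g) *v w = 0"
    by (simp flip: matrix_vector_mul_assoc)
  then show ?thesis
    by (simp add: SU3_right_inverse[OF assms(1)])
qed

text \<open>
  Write \<open>e\<^sub>2\<close> and \<open>e\<^sub>3\<close> for the last two columns of the frame, so that \<open>F\<^sub>x = l e\<^sub>2\<close> and \<open>F\<^sub>y = l e\<^sub>3\<close>.  The
  entries of \<open>a\<close> and \<open>b\<close> are the Hermitian products of the frame with its derivatives.  Comparing the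
  \<open>e\<^sub>2\<close> and \<open>e\<^sub>3\<close> components of \<open>\<partial>\<^sub>y (l e\<^sub>2) = \<partial>\<^sub>x (l e\<^sub>3)\<close> gives the two equations between imaginary parts
  and expresses \<open>l\<^sub>x\<close> and \<open>l\<^sub>y\<close> through real parts.  With these, all components of
  \<open>\<partial>\<^sub>x (l e\<^sub>2) + \<partial>\<^sub>y (l e\<^sub>3)\<close> cancel except the one along \<open>F\<close>, which skew-symmetry determines from the first
  columns.
\<close>

lemma structure_equations:
  fixes F :: "complex \<Rightarrow> complex^3"
  assumes F: "smooth_on U F" and U: "open U" and z: "z \<in> U"
    and SU: "\<And>w. w \<in> U \<Longrightarrow> adapted_frame F w \<in> SU3"
  defines "l \<equiv> norm (part_x F z)"
    and "a \<equiv> herm_transpose (adapted_frame F z) ** part_x (adapted_frame F) z"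
    and "b \<equiv> herm_transpose (adapted_frame F z) ** part_y (adapted_frame F) z"
  shows "a \<in> su3" "b \<in> su3"
    "a$1$1 = 0" "a$2$1 = of_real l" "a$3$1 = 0" "b$1$1 = 0" "b$2$1 = 0" "b$3$1 = of_real l"
    "Im (b$2$2) = Im (a$2$3)" "Im (b$3$2) = Im (a$3$3)"
    "part_x (part_x F) z + part_y (part_y F) z = (- 2 * l\<^sup>2) *\<^sub>R F z"
proof -
  define E where "E = adapted_frame F"
  define DE where "DE = frechet_derivative E (at z)"
  define \<alpha> where "\<alpha> v = herm_transpose (E z) ** DE v" for v
  define e2 where "e2 w = column 2 (E w)" for w
  define e3 where "e3 w = column 3 (E w)" for w
  define n where "n w = norm (part_x F w)" for w
  have nz: "part_x F w \<noteq> 0" if "w \<in> U" for w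
    using SU[OF that] by (rule adapted_frame_part_x_nonzero)
  have DE: "(E has_derivative DE) (at z)"
    unfolding DE_def E_def by (intro smooth_on_has_derivative[OF smooth_adapted_frame[OF F U nz]] z)
  have E: "E w \<in> SU3" if "w \<in> U" for w
    using SU[OF that] by (simp add: E_def)
  have col1: "column 1 (E w) = F w" for w
    by (simp add: E_def adapted_frame_def Let_def)
  have fx: "part_x F w = n w *\<^sub>R e2 w" and fy: "part_y F w = n w *\<^sub>R e3 w"
      if "w \<in> U" for w
    using nz[OF that] by (simp_all add: e2_def e3_def E_def adapted_frame_def Let_def n_def)
  have on: "hdot (column i (E z)) (column j (E z)) = (if i = j then 1 else 0)" for i j
    by (rule SU3_columns[OF E[OF z]])
  have ab: "a = \<alpha> 1" "b = \<alpha> \<i>"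
    by (simp_all add: a_def b_def \<alpha>_def DE_def E_def part_x_def part_y_def)
  have su: "\<alpha> v \<in> su3" for v
    unfolding \<alpha>_def by (rule Maurer_Cartan_in_su3[OF DE U z E])
  then show "a \<in> su3" "b \<in> su3"
    by (simp_all add: ab)
  have \<alpha>: "\<alpha> v $ i $ j = hdot (column i (E z)) (column j (DE v))" for v i j
    by (simp add: \<alpha>_def herm_mult_nth)
  have dcol: "((\<lambda>w. column j (E w)) has_derivative (\<lambda>v. column j (DE v))) (at z)" for j
    by (rule bounded_linear.has_derivative[OF bounded_linear_column DE])
  have "column 1 (DE v) = frechet_derivative F (at z) v" for v
    using frechet_derivative_at[OF dcol[of 1]] unfolding col1 by metis
  then have d1: "column 1 (DE 1) = l *\<^sub>R column 2 (E z)"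
      "column 1 (DE \<i>) = l *\<^sub>R column 3 (E z)"
    using fx[OF z] fy[OF z] by (simp_all add: part_x_def part_y_def e2_def e3_def n_def l_def)
  show col_a: "a$1$1 = 0" "a$2$1 = of_real l" "a$3$1 = 0"
      and col_b: "b$1$1 = 0" "b$2$1 = 0" "b$3$1 = of_real l"
    by (simp_all add: ab \<alpha> d1 hdot.scaleR_right on scaleR_conv_of_real[where 'a = complex])
  obtain n' where n': "(n has_derivative n') (at z)"
  proof -
    have "(part_x F has_derivative frechet_derivative (part_x F) (at z)) (at z)"
      by (rule smooth_on_has_derivative[OF smooth_part(1)[OF F] z])
    from has_derivative_compose[OF this GDERIV_norm[OF nz[OF z], unfolded gderiv_def]] show thesis
      using that unfolding n_def[abs_def] by blast
  qed
  have d: "frechet_derivative (part_x F) (at z) v = n z *\<^sub>R column 2 (DE v) + n' v *\<^sub>R e2 z"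
    "frechet_derivative (part_y F) (at z) v = n z *\<^sub>R column 3 (DE v) + n' v *\<^sub>R e3 z" for v
  proof -
    have prod: "((\<lambda>w. n w *\<^sub>R column j (E w)) has_derivative
        (\<lambda>v. n z *\<^sub>R column j (DE v) + n' v *\<^sub>R column j (E z))) (at z)" for j
      by (rule has_derivative_scaleR[OF n' dcol])
    have px: "(part_x F has_derivative (\<lambda>v. n z *\<^sub>R column 2 (DE v) + n' v *\<^sub>R e2 z)) (at z)"
      using has_derivative_transform_within_open[OF prod U z, of 2 "part_x F"] fx by (simp add: e2_def)
    have py: "(part_y F has_derivative (\<lambda>v. n z *\<^sub>R column 3 (DE v) + n' v *\<^sub>R e3 z)) (at z)"
      using has_derivative_transform_within_open[OF prod U z, of 3 "part_y F"] fy by (simp add: e3_def)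
    show "frechet_derivative (part_x F) (at z) v = n z *\<^sub>R column 2 (DE v) + n' v *\<^sub>R e2 z"
      using fun_cong[OF frechet_derivative_at[OF px], of v] by simp
    show "frechet_derivative (part_y F) (at z) v = n z *\<^sub>R column 3 (DE v) + n' v *\<^sub>R e3 z"
      using fun_cong[OF frechet_derivative_at[OF py], of v] by simp
  qed
  have h: "hdot (column i (E z)) (frechet_derivative (part_x F) (at z) v) =
      of_real l * \<alpha> v $ i $ 2 + (if i = 2 then of_real (n' v) else 0)"
    "hdot (column i (E z)) (frechet_derivative (part_y F) (at z) v) =
      of_real l * \<alpha> v $ i $ 3 + (if i = 3 then of_real (n' v) else 0)" for i v
    by (simp_all add: d \<alpha> hdot.add_right hdot.scaleR_right on e2_def e3_def n_def l_def
        scaleR_conv_of_real[where 'a = complex])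
  have l: "l > 0"
    using nz[OF z] by (simp add: l_def)
  have "frechet_derivative (part_x F) (at z) \<i> = frechet_derivative (part_y F) (at z) 1"
    unfolding part_x_def[abs_def] part_y_def[abs_def] by (rule mixed_derivatives_commute[OF F U z])
  then have mixed: "of_real l * b $ 2 $ 2 + of_real (n' \<i>) = of_real l * a $ 2 $ 3"
    "of_real l * b $ 3 $ 2 = of_real l * a $ 3 $ 3 + of_real (n' 1)"
    using h(1)[of 2 \<i>] h(2)[of 2 1] h(1)[of 3 \<i>] h(2)[of 3 1] by (simp_all add: ab)
  then show im: "Im (b$2$2) = Im (a$2$3)" "Im (b$3$2) = Im (a$3$3)"
    using l by (simp_all add: complex_eq_iff)
  have skew: "a$i$j = - cnj (a$j$i)" "b$i$j = - cnj (b$j$i)" for i j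
    using su unfolding ab su3_iff by (metis minus_minus)+
  have tr: "a$2$2 + a$3$3 = 0" "b$2$2 + b$3$3 = 0"
    using su col_a col_b unfolding ab su3_iff by (metis add_0)+
  note eqs = skew(1)[of 2 2, unfolded complex_eq_iff] skew(1)[of 3 2, unfolded complex_eq_iff]
    skew(1)[of 3 3, unfolded complex_eq_iff] skew(2)[of 2 2, unfolded complex_eq_iff]
    skew(2)[of 2 3, unfolded complex_eq_iff] skew(2)[of 3 3, unfolded complex_eq_iff]
    tr[unfolded complex_eq_iff]
  have "Re (b$2$2) = 0" "Re (a$3$3) = 0"
    using eqs by simp_all
  then have re: "n' \<i> = l * Re (a$2$3)" "n' 1 = l * Re (b$3$2)"
    using mixed by (simp_all add: complex_eq_iff)
  define L where "L = part_x (part_x F) z + part_y (part_y F) z"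
  have hL: "hdot (column i (E z)) L = of_real l * (a $ i $ 2 + b $ i $ 3) +
      (if i = 2 then of_real (n' 1) else 0) + (if i = 3 then of_real (n' \<i>) else 0)" for i
    unfolding L_def part_x_def[of "part_x F"] part_y_def[of "part_y F"] hdot.add_right h ab
    by (simp add: algebra_simps)
  have "hdot (column i (E z)) (L - (- 2 * l\<^sup>2) *\<^sub>R F z) = 0" for i
  proof -
    have "hdot (column i (E z)) ((- 2 * l\<^sup>2) *\<^sub>R F z) = (if i = 1 then of_real (- 2 * l\<^sup>2) else 0)"
      using on[of i 1] unfolding col1 by (simp add: hdot.minus_right hdot.scaleR_right
          scaleR_conv_of_real[where 'a = complex])
    moreover have "hdot (column i (E z)) L = (if i = 1 then of_real (- 2 * l\<^sup>2) else 0)"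
    proof -
      consider "i = 1" | "i = 2" | "i = 3"
        using exhaust_3[of i] by blast
      then show ?thesis
      proof cases
        case 1
        then show ?thesis
          unfolding hL skew(1)[of i 2] skew(2)[of i 3] using col_a col_b by (simp add: power2_eq_square)
      next
        case 2
        have "Re (a$2$2 + b$2$3) = - Re (b$3$2)" "Im (a$2$2 + b$2$3) = 0"
          using eqs im by simp_all
        then show ?thesis
          using 2 re by (simp add: hL complex_eq_iff)
      next
        case 3
        have "Re (a$3$2 + b$3$3) = - Re (a$2$3)" "Im (a$3$2 + b$3$3) = 0"
          using eqs im by simp_all
        then show ?thesis
          using 3 re by (simp add: hL complex_eq_iff)
      qed
    qed
    ultimately show ?thesis
      unfolding hdot.diff_right by simp
  qed
  then have "L - (- 2 * l\<^sup>2) *\<^sub>R F z = 0"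
    by (rule orthogonal_to_SU3_columns[OF E[OF z]])
  then show "part_x (part_x F) z + part_y (part_y F) z = (- 2 * l\<^sup>2) *\<^sub>R F z"
    by (simp add: L_def eq_neg_iff_add_eq_0)
qed

section \<open>Charts\<close>

lemma chart_subset: "is_chart X c \<Longrightarrow> fst c \<subseteq> topspace X"
  by (simp add: is_chart_def openin_subset)

lemma chart_homeomorphic:
  assumes "is_chart X c"
  shows "open_map (subtopology X (fst c)) (top_of_set (snd c ` fst c)) (snd c)" "inj_on (snd c) (fst c)"
  using assms chart_subset[OF assms]
  by (auto simp: is_chart_def homeomorphic_eq_everything_map inf_absorb2)

lemma in_chart_at: "is_chart X c \<Longrightarrow> p \<in> fst c \<Longrightarrow> in_chart c h (snd c p) = h p"
  using chart_homeomorphic(2) by (fastforce simp: in_chart_def)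

lemma open_chart_image:
  assumes "is_chart X c" "openin X V" "V \<subseteq> fst c"
  shows "open (snd c ` V)"
proof -
  have "openin (subtopology X (fst c)) V"
    using assms by (auto simp: openin_subtopology)
  then have "openin (top_of_set (snd c ` fst c)) (snd c ` V)"
    using chart_homeomorphic(1)[OF assms(1)] by (auto simp: open_map_def)
  then show ?thesis
    using assms(1) openin_open_trans by (auto simp: is_chart_def)
qed

lemma open_chart_range: "is_chart X c \<Longrightarrow> open (snd c ` fst c)"
  by (simp add: is_chart_def)

lemma open_chart_overlap: "is_chart X c \<Longrightarrow> is_chart X d \<Longrightarrow> open (snd c ` (fst c \<inter> fst d))"
  by (intro open_chart_image) (auto simp: is_chart_def)

lemma smooth_map_on_topspace:
  assumes "\<And>c. c \<in> A \<Longrightarrow> is_chart X c"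
  shows "smooth_map_on A (topspace X) h \<longleftrightarrow> (\<forall>c\<in>A. smooth_on (snd c ` fst c) (in_chart c h))"
  using chart_subset[OF assms] by (simp add: smooth_map_on_def inf_absorb1)

lemma dmap_has_derivative:
  assumes "smooth_on (snd c ` fst c) (in_chart c f)" "p \<in> fst c"
  shows "(in_chart c f has_derivative dmap c f p) (at (snd c p))"
  using smooth_on_has_derivative[OF assms(1), of "snd c p"] assms(2) by (simp add: dmap_def[abs_def])

lemma dmap_decompose:
  assumes "smooth_on (snd c ` fst c) (in_chart c f)" "p \<in> fst c"
  shows "dmap c f p w = Re w *\<^sub>R d_x c f p + Im w *\<^sub>R d_y c f p"
proof -
  have lin: "linear (dmap c f p)"
    by (rule has_derivative_linear[OF dmap_has_derivative[OF assms]])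
  have "w = Re w *\<^sub>R 1 + Im w *\<^sub>R \<i>"
    by (simp add: complex_eq_iff)
  then show ?thesis
    using linear_add[OF lin] linear_scale[OF lin] by metis
qed

text \<open>
  The tangent plane of the cone at \<open>r f\<close> is spanned by \<open>f, r f\<^sub>x, r f\<^sub>y\<close>, so the Gauss map
  does not depend on \<open>r\<close>.
\<close>

lemma cone_gauss_eq:
  assumes c: "is_chart X c" and f: "smooth_on (snd c ` fst c) (in_chart c f)" and p: "p \<in> fst c"
    and r: "r > 0"
  shows "cone_gauss c f r p = oplane (f p) (d_x c f p) (d_y c f p)"
proof -
  let ?D = "\<lambda>(s, w). r *\<^sub>R dmap c f p w + s *\<^sub>R in_chart c f (snd c p)"
  have "((\<lambda>q. fst q *\<^sub>R in_chart c f (snd q)) has_derivative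
      (\<lambda>v. fst (r, snd c p) *\<^sub>R dmap c f p (snd v) + fst v *\<^sub>R in_chart c f (snd (r, snd c p)))) (at (r, snd c p))"
    by (intro has_derivative_scaleR has_derivative_fst has_derivative_ident
        has_derivative_compose[where f = snd and g = "in_chart c f"] has_derivative_snd)
      (simp add: dmap_has_derivative[OF f p])
  then have "(cone_map c f has_derivative ?D) (at (r, snd c p))"
    by (simp add: cone_map_def case_prod_unfold)
  then have D: "frechet_derivative (cone_map c f) (at (r, snd c p)) = ?D"
    using frechet_derivative_at by metis
  have "dmap c f p 0 = 0"
    using dmap_decompose[OF f p, of 0] by simp
  then have "cone_gauss c f r p = oplane (f p) (r *\<^sub>R d_x c f p) (r *\<^sub>R d_y c f p)"
    by (simp add: cone_gauss_def D Let_def in_chart_at[OF c p])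
  then show ?thesis
    using oplane_block[of r r 0 0] r by simp
qed

lemma normal_part_eq_0: "w \<in> span B \<Longrightarrow> normal_part B w = 0"
  by (simp add: normal_part_def closest_point_self)


section \<open>Primitive maps project to minimal Legendrian maps\<close>

lemma real_column_image:
  fixes g :: "complex^3^3"
  assumes "A$1$1 = 0" "A$2$1 = of_real s" "A$3$1 = of_real t"
  shows "g *v column 1 A = s *\<^sub>R column 2 g + t *\<^sub>R column 3 g"
  using assms
  by (simp add: vec_eq_iff matrix_vector_mult_def column_def sum_3 scaleR_conv_of_real[where 'a = complex] mult.commute)

text \<open>
  The two sides of the primitivity condition are compared on the coordinates of the projection to the
  sphere.  As \<open>2 \<partial>/\<partial>z = \<partial>/\<partial>x - i \<partial>/\<partial>y\<close>, this gives \<open>f\<^sub>x = 2 g A e\<^sub>1\<close> and \<open>f\<^sub>y = - 2 g B e\<^sub>1\<close>; the factor \<open>2\<close> is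
  absorbed into \<open>s\<close> and \<open>t\<close>.
\<close>

lemma primitive_derivatives:
  assumes c: "is_chart X c" and f: "smooth_on (snd c ` fst c) (in_chart c (pi1 \<circ> \<psi>))"
      and p: "p \<in> fst c"
    and prim: "dpsi_dz c \<psi> p \<in> ghat1_fibre (\<psi> p)"
  obtains g s t where "g \<in> SU3" "flag g = \<psi> p"
    "d_x c (pi1 \<circ> \<psi>) p = s *\<^sub>R column 2 g + t *\<^sub>R column 3 g"
    "d_y c (pi1 \<circ> \<psi>) p = (- t) *\<^sub>R column 2 g + s *\<^sub>R column 3 g"
proof -
  obtain g A B where g: "g \<in> SU3" "flag g = \<psi> p"
      and AB: "A \<in> su3" "B \<in> su3" "A + mat \<i> ** B \<in> ghat1"
    and eq: "dpsi_dz c \<psi> p = tangent_vector g A B"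
    using prim unfolding ghat1_fibre_def by auto
  obtain s t where st: "A$1$1 = 0" "A$2$1 = of_real s" "A$3$1 = of_real t"
    "B$1$1 = 0" "B$2$1 = of_real t" "B$3$1 = - of_real s"
    by (rule su3_ghat1_first_column[OF AB])
  then have st': "B$3$1 = of_real (- s)"
    by simp
  have "d_x c (pi1 \<circ> \<psi>) p \<bullet> b = 2 * ((g *v column 1 A) \<bullet> b) \<and> d_y c (pi1 \<circ> \<psi>) p \<bullet> b = - 2 * ((g *v column 1 B) \<bullet> b)" for b
  proof -
    let ?h = "\<lambda>q :: flag_point. fst q \<bullet> b"
    have "in_chart c (?h \<circ> \<psi>) = (\<lambda>z. in_chart c (pi1 \<circ> \<psi>) z \<bullet> b)"
      by (simp add: in_chart_def pi1_def fun_eq_iff)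
    then have d: "dmap c (?h \<circ> \<psi>) p w = dmap c (pi1 \<circ> \<psi>) p w \<bullet> b" for w
      using frechet_derivative_inner[OF dmap_has_derivative[OF f p]] by (simp add: dmap_def)
    have "(of_real (d_x c (?h \<circ> \<psi>) p) - \<i> * of_real (d_y c (?h \<circ> \<psi>) p)) / 2 =
        Complex (curve_deriv g A ?h) (curve_deriv g B ?h)"
      using fun_cong[OF eq, of ?h] coordinate_in_smooth_FL1
      by (simp add: dpsi_dz_def tangent_vector_def)
    then show ?thesis
      unfolding d curve_deriv_coordinate[OF g(1) AB(1)] curve_deriv_coordinate[OF g(1) AB(2)]
      by (simp add: complex_eq_iff)
  qed
  then have "d_x c (pi1 \<circ> \<psi>) p = 2 *\<^sub>R (g *v column 1 A)"
      "d_y c (pi1 \<circ> \<psi>) p = (- 2) *\<^sub>R (g *v column 1 B)"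
    by (auto intro!: euclidean_eqI[of "d_x c (pi1 \<circ> \<psi>) p"] euclidean_eqI[of "d_y c (pi1 \<circ> \<psi>) p"])
  then show thesis
    using that[OF g, of "2 * s" "2 * t"] real_column_image[OF st(1-3)] real_column_image[OF st(4,5) st']
    by (simp add: algebra_simps)
qed

lemma inner_columns:
  assumes "g \<in> SU3"
  shows "column i g \<bullet> column j g = (if i = j then 1 else 0)"
  using arg_cong[OF SU3_columns[OF assms, of i j], of Re] by (simp add: Re_hdot split: if_splits)

lemma rotated_columns:
  assumes g: "g \<in> SU3"
    and u: "u = s *\<^sub>R column 2 g + t *\<^sub>R column 3 g"
        and v: "v = (- t) *\<^sub>R column 2 g + s *\<^sub>R column 3 g"
  shows "u \<bullet> u = s\<^sup>2 + t\<^sup>2" "v \<bullet> v = s\<^sup>2 + t\<^sup>2"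
      "u \<bullet> v = 0" "column 1 g \<bullet> u = 0" "column 1 g \<bullet> v = 0"
    "hdot (column 1 g) u = 0" "hdot (column 1 g) v = 0"
    "u \<noteq> 0 \<Longrightarrow> oplane (column 1 g) u v = oplane (column 1 g) (column 2 g) (column 3 g)"
proof -
  show uu: "u \<bullet> u = s\<^sup>2 + t\<^sup>2"
      and "v \<bullet> v = s\<^sup>2 + t\<^sup>2" "u \<bullet> v = 0" "column 1 g \<bullet> u = 0" "column 1 g \<bullet> v = 0"
    by (simp_all add: u v inner_add_left inner_add_right inner_diff_left inner_diff_right
        inner_columns[OF g] power2_eq_square)
  show "hdot (column 1 g) u = 0" "hdot (column 1 g) v = 0"
    by (simp_all add: u v hdot.add_right hdot.diff_right hdot.minus_right hdot.scaleR_right SU3_columns[OF g])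
  assume "u \<noteq> 0"
  then have "s * s - t * (- t) > 0"
    using uu by (simp add: power2_eq_square) (metis inner_gt_zero_iff)
  then show "oplane (column 1 g) u v = oplane (column 1 g) (column 2 g) (column 3 g)"
    unfolding u v by (rule oplane_block)
qed

text \<open>
  Where \<open>F\<close> is immersed the structure equations give the Laplacian of \<open>F\<close> as a multiple of \<open>F\<close>.  The
  set where the component \<open>Q\<close> of the Laplacian orthogonal to \<open>F\<close> is nonzero is open and consists of
  critical points only; on such an open set \<open>F\<close> is locally constant and \<open>Q\<close> vanishes after all.
\<close>

lemma laplacian_in_span:
  fixes F :: "complex \<Rightarrow> complex^3"
  assumes F: "smooth_on U F" and U: "open U"
    and sphere: "\<And>z. z \<in> U \<Longrightarrow> norm (F z) = 1"
    and frame: "\<And>z. z \<in> U \<Longrightarrow> part_x F z \<noteq> 0 \<Longrightarrow> adapted_frame F z \<in> SU3"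
    and crit: "\<And>z. z \<in> U \<Longrightarrow> part_x F z = 0 \<Longrightarrow> part_y F z = 0"
    and z: "z \<in> U"
  shows "part_x (part_x F) z + part_y (part_y F) z \<in> span {F z}"
proof -
  define L where "L w = part_x (part_x F) w + part_y (part_y F) w" for w
  define Q where "Q w = L w - (L w \<bullet> F w) *\<^sub>R F w" for w
  define R where "R = {w \<in> U. part_x F w \<noteq> 0}"
  define N where "N = {w \<in> U. Q w \<noteq> 0}"
  note cont = smooth_on_continuous_on[OF F] smooth_on_continuous_on[OF smooth_part(1)[OF F]]
    smooth_on_continuous_on[OF smooth_part(1)[OF smooth_part(1)[OF F]]]
    smooth_on_continuous_on[OF smooth_part(2)[OF smooth_part(2)[OF F]]]
  have "open R"
    unfolding R_def using continuous_open_preimage[OF cont(2) U, of "- {0}"]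
    by (simp add: vimage_def Int_def conj_commute open_Compl)
  have "continuous_on U Q"
    unfolding Q_def L_def by (intro continuous_intros cont)
  then have "open N"
    unfolding N_def using continuous_open_preimage[OF _ U, of Q "- {0}"]
    by (simp add: vimage_def Int_def conj_commute open_Compl)
  have "Q w = 0" if "w \<in> R" for w
  proof -
    have "L w = (- 2 * (norm (part_x F w))\<^sup>2) *\<^sub>R F w"
      unfolding L_def
    proof (rule structure_equations(11)[of R])
      show "smooth_on R F"
        using F by (auto simp: smooth_on_def R_def intro: Ck_on_subset)
    qed (use \<open>open R\<close> that frame in \<open>auto simp: R_def\<close>)
    moreover have "F w \<bullet> F w = 1"
      using sphere that by (simp add: R_def flip: power2_norm_eq_inner)
    ultimately show ?thesis
      by (simp add: Q_def)
  qed
  then have dis: "part_x F w = 0 \<and> part_y F w = 0" if "w \<in> N" for w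
    using that crit by (auto simp: N_def R_def)
  have "Q w = 0" if "w \<in> N" for w
  proof -
    have "(part_x F has_derivative (\<lambda>_. 0)) (at w)"
        "(part_y F has_derivative (\<lambda>_. 0)) (at w)"
      by (rule has_derivative_transform_within_open[OF has_derivative_const \<open>open N\<close> that]; simp add: dis)+
    from this[THEN frechet_derivative_at, symmetric]
    show ?thesis
      by (simp add: Q_def L_def part_x_def[of "part_x F"] part_y_def[of "part_y F"])
  qed
  then have "L z = (L z \<bullet> F z) *\<^sub>R F z"
    using z by (auto simp: N_def Q_def)
  then show ?thesis
    unfolding L_def[symmetric] by (metis span_base span_scale singletonI)
qed

lemma complex_atlas_chart: "complex_atlas X C \<Longrightarrow> c \<in> C \<Longrightarrow> is_chart X c"
  by (simp add: complex_atlas_def is_atlas_def)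

text \<open>
  The tangent plane of the cone is spanned by \<open>f, f\<^sub>x, f\<^sub>y\<close>, which are orthogonal; normalising them does
  not change the oriented plane.
\<close>

lemma adapted_frame_in_SU3:
  assumes c: "is_chart X c" and f: "smooth_on (snd c ` fst c) (in_chart c f)" and p: "p \<in> fst c"
    and SL: "oplane (f p) (d_x c f p) (d_y c f p) \<in> SL"
    and f1: "norm (f p) = 1" "f p \<bullet> d_x c f p = 0" "f p \<bullet> d_y c f p = 0"
    and conf: "norm (d_x c f p) = norm (d_y c f p)" "d_x c f p \<bullet> d_y c f p = 0"
  shows "adapted_frame (in_chart c f) (snd c p) \<in> SU3"
    and "flag (adapted_frame (in_chart c f) (snd c p)) = (f p, oplane (f p) (d_x c f p) (d_y c f p))"
proof -
  let ?r = "inverse (norm (d_x c f p))"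
  have nz: "d_x c f p \<noteq> 0"
    using SL by (rule oplane_SL_nonzero)
  have E: "adapted_frame (in_chart c f) (snd c p) = frame (f p) (?r *\<^sub>R d_x c f p) (?r *\<^sub>R d_y c f p)"
    by (simp add: adapted_frame_def Let_def part_x_def part_y_def dmap_def in_chart_at[OF c p])
  have same: "oplane (f p) (?r *\<^sub>R d_x c f p) (?r *\<^sub>R d_y c f p) = oplane (f p) (d_x c f p) (d_y c f p)"
    using oplane_block[of ?r ?r 0 0] nz by simp
  show "adapted_frame (in_chart c f) (snd c p) \<in> SU3"
    unfolding E
  proof (rule orthonormal_frame_in_SU3)
    show "oplane (f p) (?r *\<^sub>R d_x c f p) (?r *\<^sub>R d_y c f p) \<in> SL"
      unfolding same by (rule SL)
    show "norm (?r *\<^sub>R d_x c f p) = 1" "norm (?r *\<^sub>R d_y c f p) = 1"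
      unfolding norm_scaleR conf(1)[symmetric] using nz by simp_all
  qed (simp_all add: f1 conf(2))
  show "flag (adapted_frame (in_chart c f) (snd c p)) = (f p, oplane (f p) (d_x c f p) (d_y c f p))"
    by (simp add: E flag_eq same)
qed

text \<open>
  At every point the first derivatives of \<open>f\<close> are combinations of the last two columns of some \<open>g\<close> in
  \<open>SU3\<close> over \<open>\<psi>\<close>.  All first order assertions are linear algebra in this unitary basis; the second order
  ones follow from the equation for the Laplacian.
\<close>

theorem primitive_projects_to_special_lagrangian_cone:
  fixes \<psi> :: "'a \<Rightarrow> flag_point"
  assumes X: "complex_atlas X C" and prim: "primitive_harmonic X C \<psi>"
  defines "f \<equiv> pi1 \<circ> \<psi>"
  shows "special_lagrangian_cone_on C (regular_points X C f) f"
    "cone_gauss_map_on C (regular_points X C f) f (pi2 \<circ> \<psi>)"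
    "minimal_map X C f" "legendrian C f"
proof -
  have chart: "is_chart X c" if "c \<in> C" for c
    using complex_atlas_chart[OF X that] .
  have \<psi>: "\<psi> p \<in> FL1" if "p \<in> topspace X" for p
    using prim that by (auto simp: primitive_harmonic_def smooth_immersion_FL1_def)
  have sphere: "norm (f p) = 1" if "p \<in> topspace X" for p
    using \<psi>[OF that] by (auto simp: FL1_def S5_def f_def pi1_def)
  have smooth: "smooth_on (snd c ` fst c) (in_chart c f)" if c: "c \<in> C" for c
    unfolding smooth_on_def
  proof (rule allI, rule Ck_on_componentwise[OF open_chart_range[OF chart[OF c]]])
    fix k and b :: "complex^3"
    have "smooth_map_on C (topspace X) ((\<lambda>q. fst q \<bullet> b) \<circ> \<psi>)"
      using prim coordinate_in_smooth_FL1 by (simp add: primitive_harmonic_def smooth_immersion_FL1_def)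
    then have "Ck_on k (snd c ` fst c) (in_chart c ((\<lambda>q. fst q \<bullet> b) \<circ> \<psi>))"
      using c by (simp add: smooth_map_on_topspace[OF chart] smooth_on_def)
    then show "Ck_on k (snd c ` fst c) (\<lambda>z. in_chart c f z \<bullet> b)"
      by (simp add: in_chart_def f_def pi1_def o_def)
  qed
  have point: "\<exists>g s t. g \<in> SU3 \<and> flag g = \<psi> p \<and> d_x c f p = s *\<^sub>R column 2 g + t *\<^sub>R column 3 g \<and>
      d_y c f p = (- t) *\<^sub>R column 2 g + s *\<^sub>R column 3 g"
          if "c \<in> C" "p \<in> fst c" for c p
    using primitive_derivatives[OF chart[OF that(1)] smooth[OF that(1), unfolded f_def] that(2)] prim that
    unfolding f_def primitive_harmonic_def by metis
  have facts: "d_x c f p \<bullet> d_x c f p = d_y c f p \<bullet> d_y c f p"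
      "d_x c f p \<bullet> d_y c f p = 0"
    "f p \<bullet> d_x c f p = 0" "f p \<bullet> d_y c f p = 0" "hdot (f p) (d_x c f p) = 0"
        "hdot (f p) (d_y c f p) = 0"
    "d_x c f p \<noteq> 0 \<Longrightarrow> pi2 (\<psi> p) = oplane (f p) (d_x c f p) (d_y c f p)"
    "d_x c f p \<noteq> 0 \<Longrightarrow> oplane (f p) (d_x c f p) (d_y c f p) \<in> SL"
    if cp: "c \<in> C" "p \<in> fst c" for c p
  proof -
    obtain g s t where g: "g \<in> SU3" "flag g = \<psi> p"
      and d: "d_x c f p = s *\<^sub>R column 2 g + t *\<^sub>R column 3 g"
          "d_y c f p = (- t) *\<^sub>R column 2 g + s *\<^sub>R column 3 g"
      using point[OF cp] by blast
    have fp: "f p = column 1 g" and V: "pi2 (\<psi> p) = oplane (column 1 g) (column 2 g) (column 3 g)"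
      using g(2)[symmetric] by (simp_all add: f_def pi1_def pi2_def flag_eq)
    note r = rotated_columns[OF g(1) d]
    show "d_x c f p \<bullet> d_x c f p = d_y c f p \<bullet> d_y c f p"
        "d_x c f p \<bullet> d_y c f p = 0"
      "f p \<bullet> d_x c f p = 0" "f p \<bullet> d_y c f p = 0" "hdot (f p) (d_x c f p) = 0"
          "hdot (f p) (d_y c f p) = 0"
      using r(1-7) unfolding fp by simp_all
    show "pi2 (\<psi> p) = oplane (f p) (d_x c f p) (d_y c f p)" if "d_x c f p \<noteq> 0"
      using r(8)[OF that] by (simp add: V fp)
    moreover have "pi2 (\<psi> p) \<in> SL"
      unfolding V SL_iff using g(1) by blast
    ultimately show "oplane (f p) (d_x c f p) (d_y c f p) \<in> SL" if "d_x c f p \<noteq> 0"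
      using that by simp
  qed
  have conf: "norm (d_x c f p) = norm (d_y c f p)" if "c \<in> C" "p \<in> fst c" for c p
    using facts(1)[OF that] by (simp add: norm_eq_sqrt_inner)
  have reg: "d_x c f p \<noteq> 0" if "c \<in> C" "p \<in> fst c" "p \<in> regular_points X C f" for c p
  proof -
    have "inj (dmap c f p)"
      using that by (auto simp: regular_points_def)
    moreover have "dmap c f p 0 = 0"
      using dmap_decompose[OF smooth that(2), of 0] that(1) by simp
    ultimately show ?thesis
      by (metis inj_eq one_neq_zero)
  qed
  have gauss: "cone_gauss c f r p = oplane (f p) (d_x c f p) (d_y c f p)"
    if "c \<in> C" "p \<in> fst c" "r > 0" for c p r
    using cone_gauss_eq[OF chart[OF that(1)] smooth[OF that(1)] that(2,3)] .
  show "special_lagrangian_cone_on C (regular_points X C f) f"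
    unfolding special_lagrangian_cone_on_def immersion_on_def
  proof (intro conjI ballI allI impI)
    show "f ` regular_points X C f \<subseteq> S5"
      using sphere by (auto simp: regular_points_def S5_def)
    show "smooth_map_on C (regular_points X C f) f"
      using smooth by (fastforce simp: smooth_map_on_def smooth_on_def intro: Ck_on_subset)
    show "inj (dmap c f p)" if "c \<in> C" "p \<in> fst c \<inter> regular_points X C f" for c p
      using that by (auto simp: regular_points_def)
    show "cone_gauss c f r p \<in> SL"
        if "c \<in> C" "p \<in> fst c \<inter> regular_points X C f" "r > 0" for c p r
      using that gauss[of c p r] facts(8)[of c p] reg[of c p] by simp
  qed
  show "cone_gauss_map_on C (regular_points X C f) f (pi2 \<circ> \<psi>)"
    unfolding cone_gauss_map_on_def using gauss facts(7) reg by simp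
  show "legendrian C f"
    unfolding legendrian_def
  proof (intro ballI subsetI; elim rangeE)
    fix c p v w assume "c \<in> C" "p \<in> fst c" "v = dmap c f p w"
    then show "v \<in> contact_plane (f p)"
      using dmap_decompose[OF smooth, of c p w] facts(5,6)[of c p]
      by (simp add: contact_plane_iff hdot.add_right hdot.scaleR_right)
  qed
  have laplacian: "dmap2 c f p 1 1 + dmap2 c f p \<i> \<i> \<in> span {f p}"
      if c: "c \<in> C" and p: "p \<in> fst c" for c p
  proof -
    let ?U = "snd c ` fst c" and ?F = "in_chart c f"
    have at: "part_x ?F (snd c q) = d_x c f q" "part_y ?F (snd c q) = d_y c f q" "?F (snd c q) = f q"
      if "q \<in> fst c" for q
      using in_chart_at[OF chart[OF c] that] by (simp_all add: part_x_def part_y_def dmap_def)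
    have top: "q \<in> topspace X" if "q \<in> fst c" for q
      using chart_subset[OF chart[OF c]] that by blast
    have "part_x (part_x ?F) (snd c p) + part_y (part_y ?F) (snd c p) \<in> span {?F (snd c p)}"
    proof (rule laplacian_in_span[OF smooth[OF c] open_chart_range[OF chart[OF c]]])
      show "snd c p \<in> ?U"
        using p by blast
      fix z assume "z \<in> ?U"
      then obtain q where q: "q \<in> fst c" "z = snd c q"
        by blast
      show "norm (?F z) = 1"
        using sphere[OF top[OF q(1)]] at[OF q(1)] q(2) by simp
      show "part_y ?F z = 0" if "part_x ?F z = 0"
        using that conf[OF c q(1)] at[OF q(1)] q(2) by simp
      show "adapted_frame ?F z \<in> SU3" if "part_x ?F z \<noteq> 0"
        using that at[OF q(1)] facts[OF c q(1)] conf[OF c q(1)] sphere[OF top[OF q(1)]]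
        unfolding q(2) by (intro adapted_frame_in_SU3(1)[OF chart[OF c] smooth[OF c] q(1)]) simp_all
    qed
    then show ?thesis
      unfolding at(3)[OF p] by (simp add: dmap2_def part_x_def[abs_def] part_y_def[abs_def])
  qed
  show "minimal_map X C f"
    unfolding minimal_map_def
  proof (intro conjI ballI)
    show "f ` topspace X \<subseteq> S5"
      using sphere by (auto simp: S5_def)
    show "smooth_map_on C (topspace X) f"
      using smooth by (simp add: smooth_map_on_topspace[OF chart])
    show "weakly_conformal C f"
      unfolding weakly_conformal_def using conf facts(2) by blast
    show "tension c f p = 0" if "c \<in> C" "p \<in> fst c" for c p
      unfolding tension_def using laplacian[OF that] by (rule normal_part_eq_0)
    show "mean_curvature c f p = 0" if "c \<in> C" "p \<in> fst c \<inter> regular_points X C f" for c p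
    proof -
      let ?u = "d_x c f p" and ?v = "d_y c f p"
      have p: "p \<in> fst c"
        using that by blast
      have "(?u \<bullet> ?u) *\<^sub>R (dmap2 c f p 1 1 + dmap2 c f p \<i> \<i>) \<in> span {f p, ?u, ?v}"
        using laplacian[OF that(1) p] span_mono[of "{f p}" "{f p, ?u, ?v}"] by (blast intro: span_scale)
      then show ?thesis
        using facts(1,2)[OF that(1) p]
        by (simp add: mean_curvature_def normal_part_eq_0 Let_def flip: scaleR_add_right)
    qed
  qed
qed

section \<open>Links of special Lagrangian cones are primitive\<close>

lemma in_chart_transition:
  assumes "is_chart X c" "is_chart X a" "z \<in> snd c ` (fst c \<inter> fst a)"
  shows "in_chart a f (transition c a z) = in_chart c f z" "transition c a z \<in> snd a ` fst a"
  using assms(3) by (auto simp: transition_def in_chart_at[OF assms(1)] in_chart_at[OF assms(2)])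

text \<open>
  The immersion is given as a smooth map for an atlas \<open>A\<close>; smoothness and derivatives have to be
  transported to the conformal coordinates.
\<close>

lemma change_of_chart:
  assumes c: "is_chart X c" and a: "is_chart X a"
    and T: "smooth_on (snd c ` (fst c \<inter> fst a)) (transition c a)"
    and f: "smooth_on (snd a ` fst a) (in_chart a f)"
  shows "smooth_on (snd c ` (fst c \<inter> fst a)) (in_chart c f)"
    and "p \<in> fst c \<inter> fst a \<Longrightarrow>
      dmap c f p w = dmap a f p (frechet_derivative (transition c a) (at (snd c p)) w)"
proof -
  let ?V = "snd c ` (fst c \<inter> fst a)"
  have V: "open ?V"
    by (rule open_chart_overlap[OF c a])
  show "smooth_on ?V (in_chart c f)"
    unfolding smooth_on_def
  proof
    fix k
    have "Ck_on k ?V (\<lambda>z. in_chart a f (transition c a z))"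
    proof (rule Ck_on_compose[where f = "in_chart a f" and g = "transition c a", OF V])
      show "transition c a ` ?V \<subseteq> snd a ` fst a"
        using in_chart_transition(2)[OF c a] by blast
      show "Ck_on k ?V (transition c a)" "Ck_on k (snd a ` fst a) (in_chart a f)"
        using T f by (simp_all add: smooth_on_def)
    qed
    then show "Ck_on k ?V (in_chart c f)"
      using in_chart_transition(1)[OF c a] by (rule Ck_on_transform[OF V])
  qed
  assume p: "p \<in> fst c \<inter> fst a"
  then have pV: "snd c p \<in> ?V"
    by blast
  have Tp: "transition c a (snd c p) = snd a p"
    using p by (simp add: transition_def in_chart_at[OF c])
  have "(in_chart a f has_derivative dmap a f p) (at (transition c a (snd c p)))"
    unfolding Tp using dmap_has_derivative[OF f] p by blast
  from has_derivative_compose[OF smooth_on_has_derivative[OF T pV] this]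
  have "(in_chart c f has_derivative
      (\<lambda>w. dmap a f p (frechet_derivative (transition c a) (at (snd c p)) w))) (at (snd c p))"
    by (rule has_derivative_transform_within_open[OF _ V pV in_chart_transition(1)[OF c a]])
  from fun_cong[OF frechet_derivative_at[OF this], of w]
  show "dmap c f p w = dmap a f p (frechet_derivative (transition c a) (at (snd c p)) w)"
    by (simp add: dmap_def)
qed

lemma unit_sphere_orthogonal_derivative:
  fixes F :: "'a::real_normed_vector \<Rightarrow> 'b::real_inner"
  assumes D: "(F has_derivative D) (at z)"
      and U: "open U" "z \<in> U" "\<And>w. w \<in> U \<Longrightarrow> norm (F w) = 1"
  shows "F z \<bullet> D v = 0"
proof -
  have "((\<lambda>w. F w \<bullet> F w) has_derivative (\<lambda>v. F z \<bullet> D v + D v \<bullet> F z)) (at z)"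
    by (rule has_derivative_inner[OF D D])
  then have "((\<lambda>w. 1 :: real) has_derivative (\<lambda>v. F z \<bullet> D v + D v \<bullet> F z)) (at z)"
    by (rule has_derivative_transform_within_open[OF _ U(1,2)])
        (simp add: U(3) flip: power2_norm_eq_inner)
  then have "(\<lambda>v. F z \<bullet> D v + D v \<bullet> F z) = (\<lambda>v. 0)"
    using has_derivative_unique has_derivative_const by blast
  from fun_cong[OF this, of v] show ?thesis
    by (simp add: inner_commute)
qed

text \<open>
  On each conformal chart the adapted frame \<open>E\<close> is a smooth lift of \<open>\<psi> = (f, G)\<close> to \<open>SU3\<close>.  Hence a smooth
  function \<open>h\<close> on the flag manifold, extended to \<open>H\<close> near \<open>SU3\<close>, satisfies \<open>h \<circ> \<psi> = H \<circ> E\<close> there, and the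
  properties of \<open>\<psi>\<close> become properties of \<open>E\<close>: it is smooth because \<open>E\<close> is, and primitive by the structure
  equations.  The Gauss map agrees with the plane of \<open>E\<close> since the coordinate changes preserve
  orientation.
\<close>

theorem special_lagrangian_link_is_primitive:
  fixes f :: "'a \<Rightarrow> complex^3"
  assumes A: "oriented_surface X A" and sl: "special_lagrangian_cone_on A (topspace X) f"
    and G: "cone_gauss_map_on A (topspace X) f G" and C: "induced_complex_structure X A f C"
  shows "primitive_harmonic X C (\<lambda>p. (f p, G p))"
proof -
  define \<psi> where "\<psi> p = (f p, G p)" for p
  have atlas: "oriented_atlas X (A \<union> C)" "is_atlas X A" "weakly_conformal C f"
    using A C by (auto simp: induced_complex_structure_def oriented_surface_def oriented_atlas_def)
  have chart: "is_chart X c" if "c \<in> A \<union> C" for c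
    using atlas(1) that by (auto simp: oriented_atlas_def is_atlas_def)
  have sphere: "norm (f p) = 1" if "p \<in> topspace X" for p
    using sl that by (auto simp: special_lagrangian_cone_on_def S5_def)
  have smoothA: "smooth_on (snd a ` fst a) (in_chart a f)" if "a \<in> A" for a
    using sl that by (simp add: special_lagrangian_cone_on_def immersion_on_def smooth_map_on_topspace chart)
  have overlap: "\<exists>a\<in>A. p \<in> fst c \<inter> fst a \<and> snd c p \<in> snd c ` (fst c \<inter> fst a) \<and>
      smooth_on (snd c ` (fst c \<inter> fst a)) (transition c a) \<and>
      jacobian (frechet_derivative (transition c a) (at (snd c p))) > 0"
    if c: "c \<in> C" and p: "p \<in> fst c" for c p
  proof -
    have "p \<in> \<Union>(fst ` A)"
      using atlas(2) chart_subset[of X c] chart c p by (auto simp: is_atlas_def)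
    then obtain a where a: "a \<in> A" "p \<in> fst a"
      by blast
    then have "snd c p \<in> snd c ` (fst c \<inter> fst a)"
      using p by blast
    then show ?thesis
      using atlas(1) a c p unfolding oriented_atlas_def by blast
  qed
  have smooth: "smooth_on (snd c ` fst c) (in_chart c f)" if c: "c \<in> C" for c
    unfolding smooth_on_def
  proof (rule allI, rule Ck_on_local)
    fix k z assume "z \<in> snd c ` fst c"
    then obtain p where p: "p \<in> fst c" "z = snd c p"
      by blast
    then obtain a where a: "a \<in> A" "z \<in> snd c ` (fst c \<inter> fst a)"
      "smooth_on (snd c ` (fst c \<inter> fst a)) (transition c a)"
      using overlap[OF c p(1)] by blast
    have "smooth_on (snd c ` (fst c \<inter> fst a)) (in_chart c f)"
      using a c chart smoothA by (intro change_of_chart(1)[of X]) auto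
    then show "\<exists>T. open T \<and> z \<in> T \<and> Ck_on k T (in_chart c f)"
      using a c chart open_chart_overlap[of X c a] by (auto simp: smooth_on_def)
  qed
  have plane: "G p = oplane (f p) (d_x c f p) (d_y c f p)"
      "oplane (f p) (d_x c f p) (d_y c f p) \<in> SL"
    if c: "c \<in> C" and p: "p \<in> fst c" for c p
  proof -
    obtain a where a: "a \<in> A" "p \<in> fst c \<inter> fst a"
      and T: "smooth_on (snd c ` (fst c \<inter> fst a)) (transition c a)"
        "jacobian (frechet_derivative (transition c a) (at (snd c p))) > 0"
      using overlap[OF c p] by blast
    let ?T = "frechet_derivative (transition c a) (at (snd c p))"
    have ca: "is_chart X c" "is_chart X a" and pa: "p \<in> fst a" "p \<in> topspace X"
      using chart c a chart_subset[of X a] by blast+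
    have d: "dmap c f p w = Re (?T w) *\<^sub>R d_x a f p + Im (?T w) *\<^sub>R d_y a f p" for w
      unfolding change_of_chart(2)[OF ca T(1) smoothA[OF a(1)] a(2)]
      by (rule dmap_decompose[OF smoothA[OF a(1)] pa(1)])
    have "oplane (f p) (d_x c f p) (d_y c f p) = oplane (f p) (d_x a f p) (d_y a f p)"
      unfolding d using T(2) by (intro oplane_block) (simp add: jacobian_def)
    also have "\<dots> = cone_gauss a f 1 p"
      by (rule cone_gauss_eq[OF ca(2) smoothA[OF a(1)] pa(1), symmetric]) simp
    finally have eq: "oplane (f p) (d_x c f p) (d_y c f p) = cone_gauss a f 1 p" .
    show "G p = oplane (f p) (d_x c f p) (d_y c f p)"
      unfolding eq using G a(1) pa by (simp add: cone_gauss_map_on_def)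
    show "oplane (f p) (d_x c f p) (d_y c f p) \<in> SL"
      unfolding eq using sl a(1) pa by (simp add: special_lagrangian_cone_on_def)
  qed
  have conf: "norm (d_x c f p) = norm (d_y c f p)" "d_x c f p \<bullet> d_y c f p = 0"
      if "c \<in> C" "p \<in> fst c" for c p
    using atlas(3) that by (auto simp: weakly_conformal_def)
  have top: "fst c \<subseteq> topspace X" if "c \<in> C" for c
    using chart chart_subset that by blast
  have orth: "f p \<bullet> dmap c f p w = 0" if c: "c \<in> C" and p: "p \<in> fst c" for c p w
  proof -
    have ch: "is_chart X c"
      using chart c by blast
    have "in_chart c f (snd c p) \<bullet> dmap c f p w = 0"
    proof (rule unit_sphere_orthogonal_derivative[OF dmap_has_derivative[OF smooth[OF c] p] open_chart_range[OF ch]])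
      show "snd c p \<in> snd c ` fst c"
        using p by blast
      show "norm (in_chart c f z) = 1" if "z \<in> snd c ` fst c" for z
        using that sphere top[OF c] by (auto simp: in_chart_at[OF ch])
    qed
    then show ?thesis
      by (simp add: in_chart_at[OF ch p])
  qed
  define E where "E c = adapted_frame (in_chart c f)" for c
  have E: "E c (snd c p) \<in> SU3" "flag (E c (snd c p)) = \<psi> p"
      if cp: "c \<in> C" "p \<in> fst c" for c p
  proof -
    have "is_chart X c" "norm (f p) = 1"
      using chart cp sphere top[OF cp(1)] by blast+
    note frame = adapted_frame_in_SU3[OF this(1) smooth[OF cp(1)] cp(2) plane(2)[OF cp] this(2)
        orth[OF cp] orth[OF cp] conf[OF cp]]
    show "E c (snd c p) \<in> SU3"
      using frame(1) by (simp add: E_def)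
    show "flag (E c (snd c p)) = \<psi> p"
      using frame(2) plane(1)[OF cp] by (simp add: E_def \<psi>_def)
  qed
  have ESU: "E c z \<in> SU3" if "c \<in> C" "z \<in> snd c ` fst c" for c z
    using E(1) that by blast
  have Esmooth: "smooth_on (snd c ` fst c) (E c)" if c: "c \<in> C" for c
    unfolding E_def
  proof (rule smooth_adapted_frame[OF smooth[OF c]])
    show "open (snd c ` fst c)"
      using chart c open_chart_range by blast
    show "part_x (in_chart c f) z \<noteq> 0" if "z \<in> snd c ` fst c" for z
      using ESU[OF c that] adapted_frame_part_x_nonzero by (simp add: E_def)
  qed
  have lift: "in_chart c (h \<circ> \<psi>) z = H (E c z)"
    if "c \<in> C" "z \<in> snd c ` fst c" "\<And>g. g \<in> SU3 \<Longrightarrow> h (flag g) = H g"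
    for c z and h :: "flag_point \<Rightarrow> real" and H
  proof -
    obtain p where p: "p \<in> fst c" "z = snd c p"
      using \<open>z \<in> snd c ` fst c\<close> by blast
    have "in_chart c (h \<circ> \<psi>) z = h (\<psi> p)"
      using in_chart_at[OF chart p(1), of "h \<circ> \<psi>"] \<open>c \<in> C\<close> p(2) by simp
    also have "\<dots> = h (flag (E c z))"
      using E(2)[OF \<open>c \<in> C\<close> p(1)] p(2) by simp
    finally show ?thesis
      using that(3) ESU[OF that(1,2)] by simp
  qed
  have "smooth_immersion_FL1 X C \<psi>"
    unfolding smooth_immersion_FL1_def
  proof (intro conjI ballI allI impI)
    have cover: "topspace X = \<Union>(fst ` C)"
      using C by (simp add: induced_complex_structure_def complex_atlas_def is_atlas_def)
    show "\<psi> ` topspace X \<subseteq> FL1"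
      unfolding cover using E flag_in_FL1 by (auto simp flip: E(2))
    show "smooth_map_on C (topspace X) (h \<circ> \<psi>)" if h: "h \<in> smooth_FL1" for h
    proof -
      obtain W H where H: "open W" "SU3 \<subseteq> W" "smooth_on W H"
          "\<And>k. k \<in> SU3 \<Longrightarrow> h (flag k) = H k"
        using h unfolding smooth_FL1_def by auto
      have "Ck_on k (snd c ` fst c) (in_chart c (h \<circ> \<psi>))" if c: "c \<in> C" for c k
      proof -
        have U: "open (snd c ` fst c)"
          using chart c open_chart_range by blast
        have "Ck_on k (snd c ` fst c) (\<lambda>z. H (E c z))"
        proof (rule Ck_on_compose[where f = H and g = "E c" and T = W, OF U])
          show "E c ` snd c ` fst c \<subseteq> W"
            using ESU[OF c] H(2) by blast
          show "Ck_on k (snd c ` fst c) (E c)" "Ck_on k W H"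
            using Esmooth[OF c] H(3) by (simp_all add: smooth_on_def)
        qed
        then show ?thesis
          by (rule Ck_on_transform[OF U]) (simp add: lift[where h = h and H = H, OF c _ H(4)])
      qed
      then show ?thesis
        using chart by (simp add: smooth_map_on_topspace smooth_on_def)
    qed
    fix c p and w :: complex assume c: "c \<in> C" and p: "p \<in> fst c" and w: "w \<noteq> 0"
    let ?u = "d_x c f p" and ?v = "d_y c f p"
    have dw: "dmap c f p w = Re w *\<^sub>R ?u + Im w *\<^sub>R ?v"
      by (rule dmap_decompose[OF smooth[OF c] p])
    have uv: "?v \<bullet> ?v = ?u \<bullet> ?u" "?u \<bullet> ?v = 0" "?v \<bullet> ?u = 0"
      using conf[OF c p] by (simp_all add: dot_square_norm inner_commute)
    have "dmap c f p w \<bullet> dmap c f p w = ((Re w)\<^sup>2 + (Im w)\<^sup>2) * (?u \<bullet> ?u)"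
      unfolding dw by (simp add: inner_add_left inner_add_right uv algebra_simps power2_eq_square)
    moreover have "?u \<noteq> 0"
      using plane(2)[OF c p] by (rule oplane_SL_nonzero)
    ultimately have "dmap c f p w \<noteq> 0"
      using w by (auto simp: complex_eq_iff sum_power2_eq_zero_iff)
    then obtain b where b: "dmap c f p w \<bullet> b \<noteq> 0"
      by (metis inner_eq_zero_iff)
    have "in_chart c ((\<lambda>q. fst q \<bullet> b) \<circ> \<psi>) = (\<lambda>z. in_chart c f z \<bullet> b)"
      by (simp add: in_chart_def \<psi>_def fun_eq_iff)
    then have "dmap c ((\<lambda>q. fst q \<bullet> b) \<circ> \<psi>) p w = dmap c f p w \<bullet> b"
      using frechet_derivative_inner[OF dmap_has_derivative[OF smooth[OF c] p]] by (simp add: dmap_def)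
    then show "\<exists>h\<in>smooth_FL1. dmap c (h \<circ> \<psi>) p w \<noteq> 0"
      using b coordinate_in_smooth_FL1 by metis
  qed
  moreover have "dpsi_dz c \<psi> p \<in> ghat1_fibre (\<psi> p)"
      if c: "c \<in> C" and p: "p \<in> fst c" for c p
  proof -
    let ?U = "snd c ` fst c" and ?z = "snd c p"
    let ?E = "E c ?z" and ?DE = "frechet_derivative (E c) (at (snd c p))"
    have ch: "is_chart X c" and U: "open ?U" "?z \<in> ?U"
      using chart c p open_chart_range by blast+
    have SU: "adapted_frame (in_chart c f) w \<in> SU3" if "w \<in> ?U" for w
      using ESU[OF c that] by (simp add: E_def)
    note eqs = structure_equations[OF smooth[OF c] U SU, folded E_def]
    have DE: "(E c has_derivative ?DE) (at ?z)"
      by (rule smooth_on_has_derivative[OF Esmooth[OF c] U(2)])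
    have EE: "?E ** (herm_transpose ?E ** ?DE v) = ?DE v" for v
      using SU3_right_inverse[OF E(1)[OF c p]] by (simp add: matrix_mul_assoc)
    have D: "dmap c (h \<circ> \<psi>) p v = frechet_derivative H (at ?E) (?E ** (herm_transpose ?E ** ?DE v))"
      if H: "open W" "SU3 \<subseteq> W" "smooth_on W H"
          "\<And>k. k \<in> SU3 \<Longrightarrow> h (flag k) = H k"
      for h :: "flag_point \<Rightarrow> real" and W H v
    proof -
      have "(H has_derivative frechet_derivative H (at ?E)) (at ?E)"
        using smooth_on_has_derivative[OF H(3)] H(2) E(1)[OF c p] by blast
      from has_derivative_compose[OF DE this]
      have "(in_chart c (h \<circ> \<psi>) has_derivative (\<lambda>v. frechet_derivative H (at ?E) (?DE v))) (at ?z)"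
        by (rule has_derivative_transform_within_open[OF _ U])
            (simp add: lift[where h = h and H = H, OF c _ H(4)])
      from fun_cong[OF frechet_derivative_at[OF this], of v] show ?thesis
        by (simp add: dmap_def EE)
    qed
    have "dpsi_dz c \<psi> p \<in> ghat1_fibre (flag ?E)"
      unfolding dpsi_dz_def
      by (rule Maurer_Cartan_in_ghat1_fibre[OF E(1)[OF c p] eqs(1-10)])
        (auto simp: D part_x_def part_y_def)
    then show ?thesis
      by (simp add: E(2)[OF c p])
  qed
  ultimately show ?thesis
    by (simp add: primitive_harmonic_def \<psi>_def[abs_def])
qed

theorem proposition1:
  fixes X :: "'a topology" and C :: "'a chart set"
  shows
    "(\<forall>(A :: 'a chart set) (f :: 'a \<Rightarrow> complex^3) (G :: 'a \<Rightarrow> oriented_plane).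
        oriented_surface X A \<and>
        special_lagrangian_cone_on A (topspace X) f \<and>
        cone_gauss_map_on A (topspace X) f G \<and>
        induced_complex_structure X A f C
        \<longrightarrow> primitive_harmonic X C (\<lambda>p. (f p, G p)))
     \<and>
     (\<forall>\<psi> :: 'a \<Rightarrow> flag_point.
        riemann_surface X C \<and> primitive_harmonic X C \<psi>
        \<longrightarrow> special_lagrangian_cone_on C (regular_points X C (pi1 \<circ> \<psi>)) (pi1 \<circ> \<psi>) \<and>
            cone_gauss_map_on C (regular_points X C (pi1 \<circ> \<psi>)) (pi1 \<circ> \<psi>) (pi2 \<circ> \<psi>) \<and>
            minimal_map X C (pi1 \<circ> \<psi>) \<and> legendrian C (pi1 \<circ> \<psi>))"
  using special_lagrangian_link_is_primitive[of X _ _ _ C]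
    primitive_projects_to_special_lagrangian_cone[of X C]
  unfolding riemann_surface_def by blast

end
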